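(* Let $k$ be a commutative ring with unit, and let $A$ be an associative unital $k$-algebra with a free $k$-module basis $\mathcal{B}=\{\varphi_\omega\mid\omega\in\Omega\}$ such that for all $\alpha,\beta\in\Omega$ there are $\varphi_m\in\mathcal{B}$ and an idempotent $\mu_{\alpha,\beta}\in k$ with $\varphi_\alpha\varphi_\beta=\mu_{\alpha,\beta}\varphi_m$. The cochain map $\Psi:\mathrm{Hom}_k(A^{\otimes *},k)\to AP(A^{\otimes *},A)$ is a map of graded homotopy commutative algebras, i.e. for all $p,q\ge1$, $\alpha\in\mathrm{Hom}_k(A^{\otimes p},k)$ and $\beta\in\mathrm{Hom}_k(A^{\otimes q},k)$, $$\Psi(\alpha\underset{1,\,S}{\cdot}\beta)=\Psi(\alpha)\circ\Psi(\beta),$$ where $\underset{1,\,S}{\cdot}$ is Steenrod's cup-one product and $\circ$ is the pre-Lie product.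
   Context: $\Omega$ is an arbitrary index set, $\mu\in k$ is idempotent if $\mu^2=\mu$. Tensor products are over $k$. For $n\geq 1$, $AP(A^{\otimes n},A)\subseteq\mathrm{Hom}_k(A^{\otimes n},A)$ is the submodule of autopoietic cochains: those $f$ such that for all $\varphi_1,\dots,\varphi_n\in\mathcal{B}$ there is $\lambda_{\varphi_1,\dots,\varphi_n}\in k$ with $f(\varphi_1\otimes\cdots\otimes\varphi_n)=\lambda_{\varphi_1,\dots,\varphi_n}(\varphi_1\cdots\varphi_n)$. For $\alpha\in\mathrm{Hom}_k(A^{\otimes n},k)$, $\Psi(\alpha)$ is the $k$-linear map determined by $\Psi(\alpha)(\varphi_1\otimes\cdots\otimes\varphi_n)=\alpha(\varphi_1\otimes\cdots\otimes\varphi_n)\cdot(\varphi_1\varphi_2\cdots\varphi_n)$ for $\varphi_i\in\mathcal{B}$. Face maps: for $n\ge2$, $d_i:A^{\otimes n}\to A^{\otimes(n-1)}$, $0\le i\le n$, are the $k$-linear maps given on tensors of basis elements by $d_0(\varphi_1\otimes\cdots\otimes\varphi_n)=\varphi_2\otimes\cdots\otimes\varphi_n$, $d_i(\varphi_1\otimes\cdots\otimes\varphi_n)=\varphi_1\otimes\cdots\otimes\varphi_i\varphi_{i+1}\otimes\cdots\otimes\varphi_n$ for $1\le i\le n-1$, and $d_n(\varphi_1\otimes\cdots\otimes\varphi_n)=\varphi_1\otimes\cdots\otimes\varphi_{n-1}$. Cup-one product: for $\alpha\in\mathrm{Hom}_k(A^{\otimes p},k)$, $\beta\in\mathrm{Hom}_k(A^{\otimes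 q},k)$, $\alpha\underset{1,\,S}{\cdot}\beta\in\mathrm{Hom}_k(A^{\otimes(p+q-1)},k)$ is determined on $\sigma=\varphi_1\otimes\cdots\otimes\varphi_{p+q-1}$, $\varphi_i\in\mathcal{B}$, by $$(\alpha\underset{1,\,S}{\cdot}\beta)(\sigma)=\sum_{j=0}^{p-1}(-1)^{(p-1-j)(q-1)}A_jB_j,$$ $$A_j=\alpha\big((d_{j+1}d_{j+2}\cdots d_{j+q-1})(\sigma)\big),\qquad B_j=\beta\big((d_0d_1\cdots d_{j-1}\,d_{j+q+1}d_{j+q+2}\cdots d_{p+q-1})(\sigma)\big),$$ where composites of face maps are applied from right to left and empty composites are identities. Pre-Lie product: for $f\in\mathrm{Hom}_k(A^{\otimes p},A)$, $g\in\mathrm{Hom}_k(A^{\otimes q},A)$, $f\circ g=\sum_{j=0}^{p-1}(-1)^{(p-1-j)(q-1)}f\underset{(j)}{\circ}g$, where $$(f\underset{(j)}{\circ}g)(a_1\otimes\cdots\otimes a_{p+q-1})=f(a_1\otimes\cdots\otimes a_j\otimes g(a_{j+1}\otimes\cdots\otimes a_{j+q})\otimes a_{j+q+1}\otimes\cdots\otimes a_{p+q-1}).$$ *)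

theory Defs
  imports "HOL-Algebra.QuotRing" "Jordan_Normal_Form.Missing_VectorSpace"
begin

text \<open>
  The library locale \<open>algebra\<close> requires the algebra to be commutative, hence a locale of our own.
  A module record carries the fields of a ring; for modules that are not algebras the fields
  \<open>mult\<close> and \<open>one\<close> are irrelevant and left undefined.
\<close>

locale unital_algebra = module R M + M: ring M for R and M (structure) +
  assumes smult_mult_left:
      "\<lbrakk>c \<in> carrier R; x \<in> carrier M; y \<in> carrier M\<rbrakk> \<Longrightarrow> (c \<odot> x) \<otimes> y = c \<odot> (x \<otimes> y)"
    and smult_mult_right:
      "\<lbrakk>c \<in> carrier R; x \<in> carrier M; y \<in> carrier M\<rbrakk> \<Longrightarrow> x \<otimes> (c \<odot> y) = c \<odot> (x \<otimes> y)"

definition module_basis ::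
    "('k, 'r) ring_scheme \<Rightarrow> ('k, 'a, 'm) module_scheme \<Rightarrow> 'a set \<Rightarrow> bool" where
  "module_basis k M B \<longleftrightarrow>
     B \<subseteq> carrier M \<and> \<not> module.lin_dep k M B \<and> module.span k M B = carrier M"

text \<open>Homomorphisms are extensional, so that equality of functions is equality of homomorphisms.\<close>

definition Hom ::
    "('k, 'r) ring_scheme \<Rightarrow> ('k, 'a, 'm) module_scheme \<Rightarrow> ('k, 'b, 'n) module_scheme \<Rightarrow>
     ('a \<Rightarrow> 'b) set" where
  "Hom k M N = module_hom k M N \<inter> extensional (carrier M)"

definition self_module :: "('k, 'r) ring_scheme \<Rightarrow> ('k, 'k) module" where
  "self_module k =
     \<lparr>carrier = carrier k, mult = mult k, one = one k, zero = zero k, add = add k,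
      smult = mult k\<rparr>"


section \<open>Tensor powers\<close>

definition free_module :: "('k, 'r) ring_scheme \<Rightarrow> 'x set \<Rightarrow> ('k, 'x \<Rightarrow> 'k) module" where
  "free_module k X =
     \<lparr>carrier = {f. f \<in> X \<rightarrow> carrier k \<and> (\<forall>x. x \<notin> X \<longrightarrow> f x = \<zero>\<^bsub>k\<^esub>) \<and> finite {x. f x \<noteq> \<zero>\<^bsub>k\<^esub>}},
      mult = undefined, one = undefined,
      zero = (\<lambda>x. \<zero>\<^bsub>k\<^esub>),
      add = (\<lambda>f g x. f x \<oplus>\<^bsub>k\<^esub> g x),
      smult = (\<lambda>c f x. c \<otimes>\<^bsub>k\<^esub> f x)\<rparr>"

definition single :: "('k, 'r) ring_scheme \<Rightarrow> 'x \<Rightarrow> 'x \<Rightarrow> 'k" where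
  "single k x = (\<lambda>y. if y = x then \<one>\<^bsub>k\<^esub> else \<zero>\<^bsub>k\<^esub>)"

text \<open>Quotient module, in the style of \<^const>\<open>FactRing\<close>.\<close>

definition quotient_module ::
    "('k, 'a, 'm) module_scheme \<Rightarrow> 'a set \<Rightarrow> ('k, 'a set) module" where
  "quotient_module M H =
     \<lparr>carrier = a_rcosets\<^bsub>M\<^esub> H,
      mult = undefined, one = undefined,
      zero = H,
      add = set_add M,
      smult = (\<lambda>c X. \<Union>x\<in>X. H +>\<^bsub>M\<^esub> (c \<odot>\<^bsub>M\<^esub> x))\<rparr>"

definition tuples :: "'a set \<Rightarrow> nat \<Rightarrow> 'a list set" where
  "tuples X n = {xs. set xs \<subseteq> X \<and> length xs = n}"

definition tuple_module ::
    "('k, 'r) ring_scheme \<Rightarrow> ('k, 'a, 'm) module_scheme \<Rightarrow> nat \<Rightarrow> ('k, 'a list \<Rightarrow> 'k) module" where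
  "tuple_module k M n = free_module k (tuples (carrier M) n)"

definition multilinearity_relations ::
    "('k, 'r) ring_scheme \<Rightarrow> ('k, 'a, 'm) module_scheme \<Rightarrow> nat \<Rightarrow> ('a list \<Rightarrow> 'k) set" where
  "multilinearity_relations k M n =
     (let F = tuple_module k M n in
       {single k (xs @ [a \<oplus>\<^bsub>M\<^esub> b] @ ys)
          \<ominus>\<^bsub>F\<^esub> (single k (xs @ [a] @ ys) \<oplus>\<^bsub>F\<^esub> single k (xs @ [b] @ ys)) | xs ys a b.
            xs @ [a] @ ys \<in> tuples (carrier M) n \<and> b \<in> carrier M} \<union>
       {single k (xs @ [c \<odot>\<^bsub>M\<^esub> a] @ ys) \<ominus>\<^bsub>F\<^esub> c \<odot>\<^bsub>F\<^esub> single k (xs @ [a] @ ys) | xs ys a c.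
            xs @ [a] @ ys \<in> tuples (carrier M) n \<and> c \<in> carrier k})"

definition multilinearity_submodule ::
    "('k, 'r) ring_scheme \<Rightarrow> ('k, 'a, 'm) module_scheme \<Rightarrow> nat \<Rightarrow> ('a list \<Rightarrow> 'k) set" where
  "multilinearity_submodule k M n =
     module.span k (tuple_module k M n) (multilinearity_relations k M n)"

definition tensor_power ::
    "('k, 'r) ring_scheme \<Rightarrow> ('k, 'a, 'm) module_scheme \<Rightarrow> nat \<Rightarrow>
     ('k, ('a list \<Rightarrow> 'k) set) module" where
  "tensor_power k M n = quotient_module (tuple_module k M n) (multilinearity_submodule k M n)"

text \<open>\<open>pure k M [a\<^sub>1, \<dots>, a\<^sub>n]\<close> is the tensor \<open>a\<^sub>1 \<otimes> \<dots> \<otimes> a\<^sub>n\<close>.\<close>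

definition pure ::
    "('k, 'r) ring_scheme \<Rightarrow> ('k, 'a, 'm) module_scheme \<Rightarrow> 'a list \<Rightarrow> ('a list \<Rightarrow> 'k) set" where
  "pure k M as =
     multilinearity_submodule k M (length as) +>\<^bsub>tuple_module k M (length as)\<^esub> single k as"

text \<open>
  The linear map on the \<open>n\<close>-th tensor power of \<open>M\<close> determined by its values \<open>v\<close> on the tensors
  with all factors in \<open>X\<close>. It is used in two situations in which such a map exists and is unique:
  \<open>X\<close> is a basis of \<open>M\<close> and \<open>v\<close> is arbitrary, or \<open>X\<close> is the carrier of \<open>M\<close> and \<open>v\<close> is multilinear.
\<close>

definition tensor_map ::
    "('k, 'r) ring_scheme \<Rightarrow> ('k, 'a, 'm) module_scheme \<Rightarrow> 'a set \<Rightarrow> nat \<Rightarrow>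
     ('k, 'b, 'n) module_scheme \<Rightarrow> ('a list \<Rightarrow> 'b) \<Rightarrow> ('a list \<Rightarrow> 'k) set \<Rightarrow> 'b" where
  "tensor_map k M X n N v =
     (THE f. f \<in> Hom k (tensor_power k M n) N \<and> (\<forall>xs \<in> tuples X n. f (pure k M xs) = v xs))"


section \<open>Cochains\<close>

text \<open>Below, \<open>B\<close> is the chosen basis of the algebra \<open>A\<close>.\<close>

definition list_mult :: "('a, 'm) monoid_scheme \<Rightarrow> 'a list \<Rightarrow> 'a" where
  "list_mult A xs = foldr (mult A) xs \<one>\<^bsub>A\<^esub>"

definition AP ::
    "('k, 'r) ring_scheme \<Rightarrow> ('k, 'a, 'm) module_scheme \<Rightarrow> 'a set \<Rightarrow> nat \<Rightarrow>
     (('a list \<Rightarrow> 'k) set \<Rightarrow> 'a) set" where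
  "AP k A B n =
     {f \<in> Hom k (tensor_power k A n) A.
        \<forall>xs \<in> tuples B n. \<exists>l \<in> carrier k. f (pure k A xs) = l \<odot>\<^bsub>A\<^esub> list_mult A xs}"

definition Psi ::
    "('k, 'r) ring_scheme \<Rightarrow> ('k, 'a, 'm) module_scheme \<Rightarrow> 'a set \<Rightarrow> nat \<Rightarrow>
     (('a list \<Rightarrow> 'k) set \<Rightarrow> 'k) \<Rightarrow> ('a list \<Rightarrow> 'k) set \<Rightarrow> 'a" where
  "Psi k A B n \<alpha> =
     tensor_map k A B n A (\<lambda>xs. \<alpha> (pure k A xs) \<odot>\<^bsub>A\<^esub> list_mult A xs)"

text \<open>\<open>face k A B n i\<close> is the face map \<open>d\<^sub>i\<close> on the \<open>n\<close>-th tensor power, for \<open>i \<le> n\<close> and \<open>2 \<le> n\<close>;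
  lists are indexed from 0.\<close>

definition face ::
    "('k, 'r) ring_scheme \<Rightarrow> ('k, 'a, 'm) module_scheme \<Rightarrow> 'a set \<Rightarrow> nat \<Rightarrow> nat \<Rightarrow>
     ('a list \<Rightarrow> 'k) set \<Rightarrow> ('a list \<Rightarrow> 'k) set" where
  "face k A B n i =
     tensor_map k A B n (tensor_power k A (n - 1)) (\<lambda>xs. pure k A
       (if i = 0 then tl xs
        else if i < n then take (i - 1) xs @ [xs ! (i - 1) \<otimes>\<^bsub>A\<^esub> xs ! i] @ drop (i + 1) xs
        else butlast xs))"

text \<open>\<open>faces k A B n [i\<^sub>1, \<dots>, i\<^sub>r]\<close> is the composite \<open>d\<^bsub>i\<^sub>1\<^esub> \<dots> d\<^bsub>i\<^sub>r\<^esub>\<close> on the \<open>n\<close>-th tensor power, applied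
  from right to left: each face acts in the degree left by those to its right.\<close>

primrec faces ::
    "('k, 'r) ring_scheme \<Rightarrow> ('k, 'a, 'm) module_scheme \<Rightarrow> 'a set \<Rightarrow> nat \<Rightarrow> nat list \<Rightarrow>
     ('a list \<Rightarrow> 'k) set \<Rightarrow> ('a list \<Rightarrow> 'k) set" where
  "faces k A B n [] \<sigma> = \<sigma>"
| "faces k A B n (i # is) \<sigma> = face k A B (n - length is) i (faces k A B n is \<sigma>)"

definition sign :: "('k, 'r) ring_scheme \<Rightarrow> nat \<Rightarrow> 'k" where
  "sign k e = (\<ominus>\<^bsub>k\<^esub> \<one>\<^bsub>k\<^esub>) [^]\<^bsub>k\<^esub> e"

definition cup_one ::
    "('k, 'r) ring_scheme \<Rightarrow> ('k, 'a, 'm) module_scheme \<Rightarrow> 'a set \<Rightarrow> nat \<Rightarrow> nat \<Rightarrow>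
     (('a list \<Rightarrow> 'k) set \<Rightarrow> 'k) \<Rightarrow> (('a list \<Rightarrow> 'k) set \<Rightarrow> 'k) \<Rightarrow> ('a list \<Rightarrow> 'k) set \<Rightarrow> 'k" where
  "cup_one k A B p q \<alpha> \<beta> =
     tensor_map k A B (p + q - 1) (self_module k) (\<lambda>xs.
       \<Oplus>\<^bsub>k\<^esub> j \<in> {..<p}. sign k ((p - 1 - j) * (q - 1)) \<otimes>\<^bsub>k\<^esub>
         (\<alpha> (faces k A B (p + q - 1) [j + 1..<j + q] (pure k A xs)) \<otimes>\<^bsub>k\<^esub>
          \<beta> (faces k A B (p + q - 1) ([0..<j] @ [j + q + 1..<p + q]) (pure k A xs))))"

definition pre_lie_at ::
    "('k, 'r) ring_scheme \<Rightarrow> ('k, 'a, 'm) module_scheme \<Rightarrow> nat \<Rightarrow> nat \<Rightarrow> nat \<Rightarrow>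
     (('a list \<Rightarrow> 'k) set \<Rightarrow> 'a) \<Rightarrow> (('a list \<Rightarrow> 'k) set \<Rightarrow> 'a) \<Rightarrow> ('a list \<Rightarrow> 'k) set \<Rightarrow> 'a" where
  "pre_lie_at k A p q j f g =
     tensor_map k A (carrier A) (p + q - 1) A (\<lambda>as.
       f (pure k A (take j as @ [g (pure k A (take q (drop j as)))] @ drop (j + q) as)))"

definition pre_lie ::
    "('k, 'r) ring_scheme \<Rightarrow> ('k, 'a, 'm) module_scheme \<Rightarrow> nat \<Rightarrow> nat \<Rightarrow>
     (('a list \<Rightarrow> 'k) set \<Rightarrow> 'a) \<Rightarrow> (('a list \<Rightarrow> 'k) set \<Rightarrow> 'a) \<Rightarrow> ('a list \<Rightarrow> 'k) set \<Rightarrow> 'a" where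
  "pre_lie k A p q f g =
     (\<lambda>x \<in> carrier (tensor_power k A (p + q - 1)).
       \<Oplus>\<^bsub>A\<^esub> j \<in> {..<p}. sign k ((p - 1 - j) * (q - 1)) \<odot>\<^bsub>A\<^esub> pre_lie_at k A p q j f g x)"

end

theory Submission
  imports Defs
begin

text \<open>
  Both sides of the identity are linear on the tensor power of degree \<open>p + q - 1\<close>, so it suffices to
  compare them on a tensor of basis elements \<open>x\<^sub>1, \<dots>, x\<^sub>n\<close>, and there the \<open>j\<close>-th summands agree. Write
  \<open>m\<close> for the product of the block \<open>x\<^bsub>j+1\<^esub>, \<dots>, x\<^bsub>j+q\<^esub>\<close>.

  In the pre-Lie product, the block is replaced by \<open>\<beta>(x\<^bsub>j+1\<^esub> \<otimes> \<dots> \<otimes> x\<^bsub>j+q\<^esub>) m\<close>; the scalar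
  comes out by linearity, and it remains to evaluate \<open>\<Psi>(\<alpha>)\<close> on a tuple containing \<open>m\<close>, which is not a
  basis element but \<open>\<mu>\<close> times one, with \<open>\<mu>\<close> idempotent. The formula \<open>\<Psi>(\<alpha>)(\<sigma>) = \<alpha>(\<sigma>) \<cdot> (product of \<sigma>)\<close> is
  linear in \<open>\<mu>\<close> on the left and quadratic on the right, hence still correct because \<open>\<mu>\<^sup>2 = \<mu>\<close>
  (\<open>Psi_idempotent_multiples\<close>). So the summand is \<open>\<alpha>(\<dots> m \<dots>) \<beta>(x\<^bsub>j+1\<^esub> \<otimes> \<dots> \<otimes> x\<^bsub>j+q\<^esub>) x\<^sub>1 \<cdots> x\<^sub>n\<close>.

  In the cup-one product, the inner faces in the argument of \<open>\<alpha>\<close> multiply out the block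
  (\<open>faces_inner\<close>). In the argument of \<open>\<beta>\<close>, the last faces delete the entries after the block, but
  \<open>d\<^sub>0 d\<^sub>1 \<dots> d\<^bsub>j-1\<^esub>\<close> deletes the entries before it only after multiplying them together, and so leaves
  behind the idempotent \<open>\<mu>\<close> occurring in their product (\<open>faces_first\<close>). Multiplication by \<open>x\<^sub>1 \<cdots> x\<^sub>n\<close>
  absorbs it (\<open>cup_one_factors\<close>).

  The rest is multilinear algebra: the universal property of the tensor power (\<open>tensor_power_lift\<close>,
  \<open>Hom_tensor_power_eqI\<close>) and, over a basis, the multilinear extension of arbitrary values on tuples
  of basis elements (\<open>tensor_map_basis\<close>).
\<close>

section \<open>Free modules and quotient modules\<close>

lemma free_module_simps [simp]:
  "carrier (free_module k X) =
     {f. f \<in> X \<rightarrow> carrier k \<and> (\<forall>x. x \<notin> X \<longrightarrow> f x = \<zero>\<^bsub>k\<^esub>) \<and> finite {x. f x \<noteq> \<zero>\<^bsub>k\<^esub>}}"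
  "zero (free_module k X) = (\<lambda>x. \<zero>\<^bsub>k\<^esub>)"
  "add (free_module k X) f g = (\<lambda>x. f x \<oplus>\<^bsub>k\<^esub> g x)"
  "smult (free_module k X) c f = (\<lambda>x. c \<otimes>\<^bsub>k\<^esub> f x)"
  by (simp_all add: free_module_def)

lemma free_module_in_ring:
  assumes "cring k" "f \<in> carrier (free_module k X)"
  shows "f x \<in> carrier k"
proof -
  interpret cring k by fact
  show ?thesis using assms(2) by (cases "x \<in> X") auto
qed

lemma free_module_add_closed:
  assumes "cring k" "f \<in> carrier (free_module k X)" "g \<in> carrier (free_module k X)"
  shows "f \<oplus>\<^bsub>free_module k X\<^esub> g \<in> carrier (free_module k X)"
proof -
  interpret cring k by fact
  have "finite ({x. f x \<noteq> \<zero>\<^bsub>k\<^esub>} \<union> {x. g x \<noteq> \<zero>\<^bsub>k\<^esub>})" using assms by simp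
  then have "finite {x. f x \<oplus>\<^bsub>k\<^esub> g x \<noteq> \<zero>\<^bsub>k\<^esub>}" by (rule rev_finite_subset) auto
  then show ?thesis using assms by auto
qed

lemma free_module_smult_closed:
  assumes "cring k" "c \<in> carrier k" "f \<in> carrier (free_module k X)"
  shows "c \<odot>\<^bsub>free_module k X\<^esub> f \<in> carrier (free_module k X)"
proof -
  interpret cring k by fact
  have "finite {x. f x \<noteq> \<zero>\<^bsub>k\<^esub>}" using assms by simp
  then have "finite {x. c \<otimes>\<^bsub>k\<^esub> f x \<noteq> \<zero>\<^bsub>k\<^esub>}"
    by (rule rev_finite_subset) (use assms(2) in auto)
  then show ?thesis using assms by auto
qed

lemma module_free_module:
  assumes "cring k"
  shows "module k (free_module k X)"
proof -
  interpret cring k by fact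
  note in_ring = free_module_in_ring[OF assms, where X = X]
  have "abelian_group (free_module k X)"
  proof (rule abelian_groupI)
    fix f g h
    assume f: "f \<in> carrier (free_module k X)" and g: "g \<in> carrier (free_module k X)"
      and h: "h \<in> carrier (free_module k X)"
    show "(f \<oplus>\<^bsub>free_module k X\<^esub> g) \<oplus>\<^bsub>free_module k X\<^esub> h = f \<oplus>\<^bsub>free_module k X\<^esub> (g \<oplus>\<^bsub>free_module k X\<^esub> h)"
      unfolding free_module_simps by (simp add: in_ring[OF f] in_ring[OF g] in_ring[OF h] a_assoc)
  next
    fix f g assume f: "f \<in> carrier (free_module k X)" and g: "g \<in> carrier (free_module k X)"
    show "f \<oplus>\<^bsub>free_module k X\<^esub> g \<in> carrier (free_module k X)" by (rule free_module_add_closed[OF assms f g])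
    show "f \<oplus>\<^bsub>free_module k X\<^esub> g = g \<oplus>\<^bsub>free_module k X\<^esub> f"
      unfolding free_module_simps by (simp add: in_ring[OF f] in_ring[OF g] a_comm)
  next
    fix f assume f: "f \<in> carrier (free_module k X)"
    show "\<zero>\<^bsub>free_module k X\<^esub> \<oplus>\<^bsub>free_module k X\<^esub> f = f" unfolding free_module_simps by (simp add: in_ring[OF f])
    have "(\<ominus>\<^bsub>k\<^esub> \<one>\<^bsub>k\<^esub>) \<odot>\<^bsub>free_module k X\<^esub> f \<oplus>\<^bsub>free_module k X\<^esub> f = \<zero>\<^bsub>free_module k X\<^esub>"
      unfolding free_module_simps by (simp add: in_ring[OF f] l_minus l_neg)
    then show "\<exists>g\<in>carrier (free_module k X). g \<oplus>\<^bsub>free_module k X\<^esub> f = \<zero>\<^bsub>free_module k X\<^esub>"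
      using free_module_smult_closed[OF assms _ f, of "\<ominus>\<^bsub>k\<^esub> \<one>\<^bsub>k\<^esub>"] by blast
  qed simp
  then show ?thesis
  proof (rule moduleI[OF assms])
    fix c f assume c: "c \<in> carrier k" and f: "f \<in> carrier (free_module k X)"
    show "c \<odot>\<^bsub>free_module k X\<^esub> f \<in> carrier (free_module k X)" by (rule free_module_smult_closed[OF assms c f])
  next
    fix c d f assume cd: "c \<in> carrier k" "d \<in> carrier k" and f: "f \<in> carrier (free_module k X)"
    show "(c \<oplus>\<^bsub>k\<^esub> d) \<odot>\<^bsub>free_module k X\<^esub> f = c \<odot>\<^bsub>free_module k X\<^esub> f \<oplus>\<^bsub>free_module k X\<^esub> d \<odot>\<^bsub>free_module k X\<^esub> f"
      unfolding free_module_simps by (simp add: cd in_ring[OF f] l_distr)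
    show "(c \<otimes>\<^bsub>k\<^esub> d) \<odot>\<^bsub>free_module k X\<^esub> f = c \<odot>\<^bsub>free_module k X\<^esub> (d \<odot>\<^bsub>free_module k X\<^esub> f)"
      unfolding free_module_simps by (simp add: cd in_ring[OF f] m_assoc)
  next
    fix c f g assume c: "c \<in> carrier k" and f: "f \<in> carrier (free_module k X)"
      and g: "g \<in> carrier (free_module k X)"
    show "c \<odot>\<^bsub>free_module k X\<^esub> (f \<oplus>\<^bsub>free_module k X\<^esub> g) = c \<odot>\<^bsub>free_module k X\<^esub> f \<oplus>\<^bsub>free_module k X\<^esub> c \<odot>\<^bsub>free_module k X\<^esub> g"
      unfolding free_module_simps by (simp add: c in_ring[OF f] in_ring[OF g] r_distr)
  next
    fix f assume f: "f \<in> carrier (free_module k X)"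
    show "\<one>\<^bsub>k\<^esub> \<odot>\<^bsub>free_module k X\<^esub> f = f" unfolding free_module_simps by (simp add: in_ring[OF f])
  qed
qed

lemma single_closed:
  assumes "cring k" "x \<in> X"
  shows "single k x \<in> carrier (free_module k X)"
proof -
  interpret cring k by fact
  have "finite {y. single k x y \<noteq> \<zero>\<^bsub>k\<^esub>}"
    by (rule finite_subset[of _ "{x}"]) (auto simp: single_def)
  then show ?thesis using assms(2) by (auto simp: single_def)
qed

lemma free_module_induct [consumes 2, case_names zero add_smult_single]:
  assumes "cring k" and f: "f \<in> carrier (free_module k X)"
    and zero: "P \<zero>\<^bsub>free_module k X\<^esub>"
    and step: "\<And>c x g. \<lbrakk>c \<in> carrier k; x \<in> X; g \<in> carrier (free_module k X); P g\<rbrakk> \<Longrightarrow>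
        P (c \<odot>\<^bsub>free_module k X\<^esub> single k x \<oplus>\<^bsub>free_module k X\<^esub> g)"
  shows "P f"
proof -
  interpret cring k by fact
  have "finite {x. f x \<noteq> \<zero>\<^bsub>k\<^esub>}" using f by simp
  then show ?thesis using f
  proof (induction "{x. f x \<noteq> \<zero>\<^bsub>k\<^esub>}" arbitrary: f rule: finite_induct)
    case empty
    then have "f = \<zero>\<^bsub>free_module k X\<^esub>" by auto
    then show ?case using zero by simp
  next
    case (insert x S)
    let ?g = "f(x := \<zero>\<^bsub>k\<^esub>)"
    have S: "S = {y. ?g y \<noteq> \<zero>\<^bsub>k\<^esub>}" using insert.hyps(2,4) by auto
    have "f x \<noteq> \<zero>\<^bsub>k\<^esub>" using insert.hyps(4) by auto
    then have x: "x \<in> X" using insert.prems by auto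
    have g: "?g \<in> carrier (free_module k X)"
      using insert.prems insert.hyps(1) S by auto
    have "f y \<in> carrier k" for y using free_module_in_ring[OF assms(1) insert.prems] .
    then have "f = f x \<odot>\<^bsub>free_module k X\<^esub> single k x \<oplus>\<^bsub>free_module k X\<^esub> ?g"
      by (auto simp: fun_eq_iff single_def)
    moreover have "P ?g" using insert.hyps(3)[OF S g] .
    ultimately show ?case
      using step[OF _ x g] free_module_in_ring[OF assms(1) insert.prems] by metis
  qed
qed

text \<open>The linear extension of \<open>w\<close> to the free module: \<open>f\<close> is sent to \<open>\<Sum>\<^sub>x f(x) w(x)\<close>.\<close>

definition free_ext ::
    "('k, 'r) ring_scheme \<Rightarrow> ('k, 'b, 'n) module_scheme \<Rightarrow> ('x \<Rightarrow> 'b) \<Rightarrow> ('x \<Rightarrow> 'k) \<Rightarrow> 'b" where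
  "free_ext k N w f = (\<Oplus>\<^bsub>N\<^esub> x \<in> {x. f x \<noteq> \<zero>\<^bsub>k\<^esub>}. f x \<odot>\<^bsub>N\<^esub> w x)"

lemma free_ext_eq:
  assumes "module k N" "f \<in> carrier (free_module k X)" "w \<in> X \<rightarrow> carrier N"
    and "finite S" "{x. f x \<noteq> \<zero>\<^bsub>k\<^esub>} \<subseteq> S" "S \<subseteq> X"
  shows "free_ext k N w f = (\<Oplus>\<^bsub>N\<^esub> x \<in> S. f x \<odot>\<^bsub>N\<^esub> w x)"
proof -
  interpret N: module k N by fact
  have w: "w x \<in> carrier N" if "x \<in> S" for x using that assms by auto
  then have "f x \<odot>\<^bsub>N\<^esub> w x \<in> carrier N" if "x \<in> S" for x
    using that free_module_in_ring[OF N.R.is_cring assms(2)] by (auto intro!: N.smult_closed)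
  then show ?thesis unfolding free_ext_def
    using assms(4-6) w by (intro N.add.finprod_mono_neutral_cong_left) auto
qed

lemma free_ext_hom:
  assumes "module k N" and w: "w \<in> X \<rightarrow> carrier N"
  shows "free_ext k N w \<in> module_hom k (free_module k X) N"
proof -
  interpret N: module k N by fact
  note in_ring = free_module_in_ring[OF N.R.is_cring, of _ X]
  have supp: "{x. f x \<noteq> \<zero>\<^bsub>k\<^esub>} \<subseteq> X" "finite {x. f x \<noteq> \<zero>\<^bsub>k\<^esub>}"
    if "f \<in> carrier (free_module k X)" for f using that by auto
  have closed: "f x \<odot>\<^bsub>N\<^esub> w x \<in> carrier N" if "f \<in> carrier (free_module k X)" "x \<in> X" for f x
    using that w by (auto intro!: N.smult_closed)
  have "free_ext k N w f \<in> carrier N" if "f \<in> carrier (free_module k X)" for f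
    unfolding free_ext_def using closed[OF that] supp[OF that] by (intro N.finsum_closed) auto
  moreover have "free_ext k N w (f \<oplus>\<^bsub>free_module k X\<^esub> g) = free_ext k N w f \<oplus>\<^bsub>N\<^esub> free_ext k N w g"
    if f: "f \<in> carrier (free_module k X)" and g: "g \<in> carrier (free_module k X)" for f g
  proof -
    interpret F: module k "free_module k X" by (rule module_free_module) (rule N.R.is_cring)
    let ?S = "{x. f x \<noteq> \<zero>\<^bsub>k\<^esub>} \<union> {x. g x \<noteq> \<zero>\<^bsub>k\<^esub>}"
    have S: "finite ?S" "?S \<subseteq> X" using supp[OF f] supp[OF g] by auto
    have "free_ext k N w (f \<oplus>\<^bsub>free_module k X\<^esub> g)
        = (\<Oplus>\<^bsub>N\<^esub> x \<in> ?S. (f \<oplus>\<^bsub>free_module k X\<^esub> g) x \<odot>\<^bsub>N\<^esub> w x)"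
      using F.M.a_closed[OF f g] by (rule free_ext_eq[OF assms(1) _ w S(1) _ S(2)]) auto
    also have "\<dots> = (\<Oplus>\<^bsub>N\<^esub> x \<in> ?S. f x \<odot>\<^bsub>N\<^esub> w x \<oplus>\<^bsub>N\<^esub> g x \<odot>\<^bsub>N\<^esub> w x)"
    proof (rule N.finsum_cong')
      show "(f \<oplus>\<^bsub>free_module k X\<^esub> g) x \<odot>\<^bsub>N\<^esub> w x = f x \<odot>\<^bsub>N\<^esub> w x \<oplus>\<^bsub>N\<^esub> g x \<odot>\<^bsub>N\<^esub> w x" if "x \<in> ?S" for x
      proof -
        have "w x \<in> carrier N" using that S w by auto
        then show ?thesis using in_ring[OF f] in_ring[OF g] by (simp add: N.smult_l_distr)
      qed
    qed (use closed[OF f] closed[OF g] S(2) in auto)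
    also have "\<dots> = (\<Oplus>\<^bsub>N\<^esub> x \<in> ?S. f x \<odot>\<^bsub>N\<^esub> w x) \<oplus>\<^bsub>N\<^esub> (\<Oplus>\<^bsub>N\<^esub> x \<in> ?S. g x \<odot>\<^bsub>N\<^esub> w x)"
      using closed[OF f] closed[OF g] S by (intro N.finsum_addf) auto
    also have "\<dots> = free_ext k N w f \<oplus>\<^bsub>N\<^esub> free_ext k N w g"
      using free_ext_eq[OF assms(1) f w S(1) _ S(2)] free_ext_eq[OF assms(1) g w S(1) _ S(2)] by simp
    finally show ?thesis .
  qed
  moreover have "free_ext k N w (c \<odot>\<^bsub>free_module k X\<^esub> f) = c \<odot>\<^bsub>N\<^esub> free_ext k N w f"
    if c: "c \<in> carrier k" and f: "f \<in> carrier (free_module k X)" for c f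
  proof -
    interpret F: module k "free_module k X" by (rule module_free_module) (rule N.R.is_cring)
    let ?S = "{x. f x \<noteq> \<zero>\<^bsub>k\<^esub>}"
    have "free_ext k N w (c \<odot>\<^bsub>free_module k X\<^esub> f)
        = (\<Oplus>\<^bsub>N\<^esub> x \<in> ?S. (c \<odot>\<^bsub>free_module k X\<^esub> f) x \<odot>\<^bsub>N\<^esub> w x)"
      by (rule free_ext_eq[OF assms(1) F.smult_closed[OF c f] w supp(2)[OF f] _ supp(1)[OF f]])
         (use c in auto)
    also have "\<dots> = (\<Oplus>\<^bsub>N\<^esub> x \<in> ?S. c \<odot>\<^bsub>N\<^esub> (f x \<odot>\<^bsub>N\<^esub> w x))"
    proof (rule N.finsum_cong')
      show "(c \<odot>\<^bsub>free_module k X\<^esub> f) x \<odot>\<^bsub>N\<^esub> w x = c \<odot>\<^bsub>N\<^esub> (f x \<odot>\<^bsub>N\<^esub> w x)" if "x \<in> ?S" for x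
      proof -
        have "w x \<in> carrier N" using that supp[OF f] w by auto
        then show ?thesis using in_ring[OF f] c by (simp add: N.smult_assoc1)
      qed
    qed (use closed[OF f] supp(1)[OF f] c in auto)
    also have "\<dots> = c \<odot>\<^bsub>N\<^esub> free_ext k N w f"
      unfolding free_ext_def using closed[OF f] supp[OF f] c
      by (intro N.finsum_smult_ldistr[symmetric]) auto
    finally show ?thesis .
  qed
  ultimately show ?thesis unfolding module_hom_def by auto
qed

lemma free_ext_single:
  assumes "module k N" "w \<in> X \<rightarrow> carrier N" "x \<in> X"
  shows "free_ext k N w (single k x) = w x"
proof -
  interpret N: module k N by fact
  have "free_ext k N w (single k x) = (\<Oplus>\<^bsub>N\<^esub> y \<in> {x}. single k x y \<odot>\<^bsub>N\<^esub> w y)"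
    using assms single_closed[OF N.R.is_cring assms(3)]
    by (intro free_ext_eq) (auto simp: single_def)
  then show ?thesis using assms(2,3) by (auto simp: single_def Pi_iff)
qed

text \<open>The linear extension of \<open>w\<close> depends linearly on \<open>w\<close> as well: this is what makes an
  entry-by-entry extension multilinear.\<close>

lemma free_ext_arg_hom:
  assumes "module k M" "module k N" "c \<in> carrier (free_module k X)"
    and W: "\<And>x. x \<in> X \<Longrightarrow> (\<lambda>a. W a x) \<in> module_hom k M N"
  shows "(\<lambda>a. free_ext k N (W a) c) \<in> module_hom k M N"
proof -
  interpret M: module k M by fact
  interpret N: module k N by fact
  let ?S = "{x. c x \<noteq> \<zero>\<^bsub>k\<^esub>}"
  have S: "?S \<subseteq> X" "finite ?S" using assms(3) by auto
  have c: "c x \<in> carrier k" for x by (rule free_module_in_ring[OF M.R.is_cring assms(3)])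
  have Wc: "W a x \<in> carrier N" if "a \<in> carrier M" "x \<in> ?S" for a x
    using W[of x] that S by (auto simp: module_hom_def Pi_iff)
  have Wadd: "W (a \<oplus>\<^bsub>M\<^esub> b) x = W a x \<oplus>\<^bsub>N\<^esub> W b x"
    if "a \<in> carrier M" "b \<in> carrier M" "x \<in> ?S" for a b x
    using W[of x] that S by (auto simp: module_hom_def)
  have Wsm: "W (r \<odot>\<^bsub>M\<^esub> a) x = r \<odot>\<^bsub>N\<^esub> W a x"
    if "r \<in> carrier k" "a \<in> carrier M" "x \<in> ?S" for a r x
    using W[of x] that S by (auto simp: module_hom_def)
  have 1: "free_ext k N (W a) c \<in> carrier N" if "a \<in> carrier M" for a
    unfolding free_ext_def using c Wc that by (intro N.finsum_closed) auto
  have 2: "free_ext k N (W (a \<oplus>\<^bsub>M\<^esub> b)) c = free_ext k N (W a) c \<oplus>\<^bsub>N\<^esub> free_ext k N (W b) c"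
    if ab: "a \<in> carrier M" "b \<in> carrier M" for a b
  proof -
    have "free_ext k N (W (a \<oplus>\<^bsub>M\<^esub> b)) c = (\<Oplus>\<^bsub>N\<^esub> x \<in> ?S. c x \<odot>\<^bsub>N\<^esub> W a x \<oplus>\<^bsub>N\<^esub> c x \<odot>\<^bsub>N\<^esub> W b x)"
      unfolding free_ext_def using c Wc ab
      by (intro N.finsum_cong') (auto simp: Wadd N.smult_r_distr)
    also have "\<dots> = free_ext k N (W a) c \<oplus>\<^bsub>N\<^esub> free_ext k N (W b) c"
      unfolding free_ext_def using c Wc ab by (intro N.finsum_addf) auto
    finally show ?thesis .
  qed
  have 3: "free_ext k N (W (r \<odot>\<^bsub>M\<^esub> a)) c = r \<odot>\<^bsub>N\<^esub> free_ext k N (W a) c"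
    if ra: "r \<in> carrier k" "a \<in> carrier M" for r a
  proof -
    have "free_ext k N (W (r \<odot>\<^bsub>M\<^esub> a)) c = (\<Oplus>\<^bsub>N\<^esub> x \<in> ?S. r \<odot>\<^bsub>N\<^esub> (c x \<odot>\<^bsub>N\<^esub> W a x))"
      unfolding free_ext_def using c Wc ra
      by (intro N.finsum_cong')
         (auto simp: Wsm N.smult_assoc1[symmetric] M.R.m_comm)
    also have "\<dots> = r \<odot>\<^bsub>N\<^esub> free_ext k N (W a) c"
      unfolding free_ext_def using c Wc ra S by (intro N.finsum_smult_ldistr[symmetric]) auto
    finally show ?thesis .
  qed
  show ?thesis unfolding module_hom_def using 1 2 3 by auto
qed

lemma quotient_module_simps:
  "carrier (quotient_module M H) = a_rcosets\<^bsub>M\<^esub> H"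
  "zero (quotient_module M H) = H"
  "add (quotient_module M H) = set_add M"
  "smult (quotient_module M H) c X = (\<Union>x\<in>X. H +>\<^bsub>M\<^esub> (c \<odot>\<^bsub>M\<^esub> x))"
  by (simp_all add: quotient_module_def)

context
  fixes k :: "('k, 'r) ring_scheme" and M :: "('k, 'a, 'm) module_scheme" and H
  assumes H: "LinearCombinations.submodule k H M"
begin

interpretation M: module k M by (rule LinearCombinations.submodule.module[OF H])

lemma abelian_subgroup_submodule: "abelian_subgroup H M"
proof (rule abelian_subgroupI3[OF additive_subgroupI M.abelian_group_axioms])
  note sub = LinearCombinations.submodule.subset[OF H]
  show "subgroup H (add_monoid M)"
  proof (rule M.add.subgroupI)
    show "H \<noteq> {}" using LinearCombinations.submodule.zero_closed[OF H] by auto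
    show "\<ominus>\<^bsub>M\<^esub> h \<in> H" if "h \<in> H" for h
    proof -
      have "(\<ominus>\<^bsub>k\<^esub> \<one>\<^bsub>k\<^esub>) \<odot>\<^bsub>M\<^esub> h \<in> H" using LinearCombinations.submodule.smult_closed[OF H] that by simp
      then show ?thesis using that sub by (auto simp: M.smult_l_minus)
    qed
  qed (use sub LinearCombinations.submodule.m_closed[OF H] in auto)
qed

interpretation Q: abelian_subgroup H M by (rule abelian_subgroup_submodule)

lemma coset_closed: "x \<in> carrier M \<Longrightarrow> H +>\<^bsub>M\<^esub> x \<in> carrier (quotient_module M H)"
  by (simp add: quotient_module_simps M.a_rcosetsI Q.a_subset)

lemma coset_cases:
  assumes "X \<in> carrier (quotient_module M H)"
  obtains x where "x \<in> carrier M" "X = H +>\<^bsub>M\<^esub> x"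
  using assms by (auto simp: quotient_module_simps A_RCOSETS_def')

lemma coset_add:
  "x \<in> carrier M \<Longrightarrow> y \<in> carrier M \<Longrightarrow>
     (H +>\<^bsub>M\<^esub> x) \<oplus>\<^bsub>quotient_module M H\<^esub> (H +>\<^bsub>M\<^esub> y) = H +>\<^bsub>M\<^esub> (x \<oplus>\<^bsub>M\<^esub> y)"
  by (simp add: quotient_module_simps Q.a_rcos_sum)

lemma coset_eq_iff:
  assumes "x \<in> carrier M" "y \<in> carrier M"
  shows "H +>\<^bsub>M\<^esub> x = H +>\<^bsub>M\<^esub> y \<longleftrightarrow> x \<ominus>\<^bsub>M\<^esub> y \<in> H"
  using assms Q.a_rcos_module[of y x] Q.a_repr_independence'[of x y] Q.a_rcos_self[of x]
  unfolding a_minus_def by metis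

lemma coset_smult:
  assumes c: "c \<in> carrier k" and x: "x \<in> carrier M"
  shows "c \<odot>\<^bsub>quotient_module M H\<^esub> (H +>\<^bsub>M\<^esub> x) = H +>\<^bsub>M\<^esub> (c \<odot>\<^bsub>M\<^esub> x)"
proof -
  have "H +>\<^bsub>M\<^esub> (c \<odot>\<^bsub>M\<^esub> y) = H +>\<^bsub>M\<^esub> (c \<odot>\<^bsub>M\<^esub> x)" if y: "y \<in> H +>\<^bsub>M\<^esub> x" for y
  proof -
    have yc: "y \<in> carrier M" using Q.a_elemrcos_carrier[OF x y] .
    have "y \<ominus>\<^bsub>M\<^esub> x \<in> H" using Q.a_rcos_module_imp[OF x y] by (simp add: a_minus_def)
    then have "c \<odot>\<^bsub>M\<^esub> (y \<ominus>\<^bsub>M\<^esub> x) \<in> H" using LinearCombinations.submodule.smult_closed[OF H c] by simp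
    then have "c \<odot>\<^bsub>M\<^esub> y \<ominus>\<^bsub>M\<^esub> c \<odot>\<^bsub>M\<^esub> x \<in> H"
      using c x yc by (simp add: a_minus_def M.smult_r_distr M.smult_r_minus)
    then show ?thesis using coset_eq_iff c x yc by simp
  qed
  then have "(\<Union>y\<in>H +>\<^bsub>M\<^esub> x. H +>\<^bsub>M\<^esub> (c \<odot>\<^bsub>M\<^esub> y)) = (\<Union>y\<in>H +>\<^bsub>M\<^esub> x. H +>\<^bsub>M\<^esub> (c \<odot>\<^bsub>M\<^esub> x))"
    by (rule SUP_cong[OF refl])
  moreover have "H +>\<^bsub>M\<^esub> x \<noteq> {}" using Q.a_rcos_self[OF x] by blast
  ultimately show ?thesis unfolding quotient_module_simps UN_constant by (simp only: if_False)
qed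

lemma module_quotient_module: "module k (quotient_module M H)"
proof -
  have zero: "\<zero>\<^bsub>quotient_module M H\<^esub> = H +>\<^bsub>M\<^esub> \<zero>\<^bsub>M\<^esub>"
    using Q.a_rcos_const by (simp add: quotient_module_simps)
  have "abelian_group (quotient_module M H)"
  proof (rule abelian_groupI)
    fix X Y Z
    assume "X \<in> carrier (quotient_module M H)" "Y \<in> carrier (quotient_module M H)"
      "Z \<in> carrier (quotient_module M H)"
    then show "(X \<oplus>\<^bsub>quotient_module M H\<^esub> Y) \<oplus>\<^bsub>quotient_module M H\<^esub> Z = X \<oplus>\<^bsub>quotient_module M H\<^esub> (Y \<oplus>\<^bsub>quotient_module M H\<^esub> Z)"
      by (elim coset_cases) (simp add: coset_add M.a_assoc)
  next
    fix X Y assume "X \<in> carrier (quotient_module M H)" "Y \<in> carrier (quotient_module M H)"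
    then obtain x y where xy: "x \<in> carrier M" "X = H +>\<^bsub>M\<^esub> x" "y \<in> carrier M" "Y = H +>\<^bsub>M\<^esub> y"
      by (elim coset_cases)
    show "X \<oplus>\<^bsub>quotient_module M H\<^esub> Y \<in> carrier (quotient_module M H)"
      using xy coset_closed[of "x \<oplus>\<^bsub>M\<^esub> y"] by (simp add: coset_add)
    show "X \<oplus>\<^bsub>quotient_module M H\<^esub> Y = Y \<oplus>\<^bsub>quotient_module M H\<^esub> X"
      using xy by (simp add: coset_add M.a_comm)
  next
    show "\<zero>\<^bsub>quotient_module M H\<^esub> \<in> carrier (quotient_module M H)" unfolding zero by (rule coset_closed) simp
    fix X assume "X \<in> carrier (quotient_module M H)"
    then obtain x where x: "x \<in> carrier M" "X = H +>\<^bsub>M\<^esub> x" by (rule coset_cases)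
    show "\<zero>\<^bsub>quotient_module M H\<^esub> \<oplus>\<^bsub>quotient_module M H\<^esub> X = X" unfolding zero x(2) using x(1) by (simp add: coset_add del: M.a_coset_add_zero)
    have "(H +>\<^bsub>M\<^esub> (\<ominus>\<^bsub>M\<^esub> x)) \<oplus>\<^bsub>quotient_module M H\<^esub> X = \<zero>\<^bsub>quotient_module M H\<^esub>"
      unfolding zero x(2) using x(1) by (simp add: coset_add M.l_neg)
    then show "\<exists>Y\<in>carrier (quotient_module M H). Y \<oplus>\<^bsub>quotient_module M H\<^esub> X = \<zero>\<^bsub>quotient_module M H\<^esub>"
      by (rule bexI) (rule coset_closed, simp add: x(1))
  qed
  then show ?thesis
  proof (rule moduleI[OF M.R.is_cring])
    fix c X assume c: "c \<in> carrier k" and "X \<in> carrier (quotient_module M H)"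
    then obtain x where x: "x \<in> carrier M" "X = H +>\<^bsub>M\<^esub> x" by (elim coset_cases)
    show "c \<odot>\<^bsub>quotient_module M H\<^esub> X \<in> carrier (quotient_module M H)"
      unfolding x(2) coset_smult[OF c x(1)] by (rule coset_closed) (simp add: c x(1))
  next
    fix c d X assume cd: "c \<in> carrier k" "d \<in> carrier k" and "X \<in> carrier (quotient_module M H)"
    then obtain x where x: "x \<in> carrier M" "X = H +>\<^bsub>M\<^esub> x" by (elim coset_cases)
    show "(c \<oplus>\<^bsub>k\<^esub> d) \<odot>\<^bsub>quotient_module M H\<^esub> X = c \<odot>\<^bsub>quotient_module M H\<^esub> X \<oplus>\<^bsub>quotient_module M H\<^esub> d \<odot>\<^bsub>quotient_module M H\<^esub> X"
      unfolding x(2) by (simp add: coset_smult coset_add cd x(1) M.smult_l_distr)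
    show "(c \<otimes>\<^bsub>k\<^esub> d) \<odot>\<^bsub>quotient_module M H\<^esub> X = c \<odot>\<^bsub>quotient_module M H\<^esub> (d \<odot>\<^bsub>quotient_module M H\<^esub> X)"
      unfolding x(2) by (simp add: coset_smult cd x(1) M.smult_assoc1)
  next
    fix c X Y assume c: "c \<in> carrier k" and "X \<in> carrier (quotient_module M H)"
      "Y \<in> carrier (quotient_module M H)"
    then obtain x y where xy: "x \<in> carrier M" "X = H +>\<^bsub>M\<^esub> x" "y \<in> carrier M" "Y = H +>\<^bsub>M\<^esub> y"
      by (elim coset_cases)
    show "c \<odot>\<^bsub>quotient_module M H\<^esub> (X \<oplus>\<^bsub>quotient_module M H\<^esub> Y) = c \<odot>\<^bsub>quotient_module M H\<^esub> X \<oplus>\<^bsub>quotient_module M H\<^esub> c \<odot>\<^bsub>quotient_module M H\<^esub> Y"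
      unfolding xy(2,4) by (simp add: coset_smult coset_add c xy(1,3) M.smult_r_distr)
  next
    fix X assume "X \<in> carrier (quotient_module M H)"
    then show "\<one>\<^bsub>k\<^esub> \<odot>\<^bsub>quotient_module M H\<^esub> X = X" by (elim coset_cases) (simp add: coset_smult)
  qed
qed

text \<open>A linear map vanishing on \<open>H\<close> factors through the quotient by \<open>H\<close>.\<close>

lemma quotient_module_lift:
  assumes "module k N" and f: "f \<in> module_hom k M N" and f0: "\<And>h. h \<in> H \<Longrightarrow> f h = \<zero>\<^bsub>N\<^esub>"
  shows "\<exists>g \<in> Hom k (quotient_module M H) N. \<forall>x \<in> carrier M. g (H +>\<^bsub>M\<^esub> x) = f x"
proof -
  interpret N: module k N by fact
  interpret f: mod_hom k M N f using f by unfold_locales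
  define g where "g = (\<lambda>X \<in> carrier (quotient_module M H). f (SOME x. x \<in> carrier M \<and> X = H +>\<^bsub>M\<^esub> x))"
  have g: "g (H +>\<^bsub>M\<^esub> x) = f x" if x: "x \<in> carrier M" for x
  proof -
    let ?y = "SOME y. y \<in> carrier M \<and> H +>\<^bsub>M\<^esub> x = H +>\<^bsub>M\<^esub> y"
    have y: "?y \<in> carrier M \<and> H +>\<^bsub>M\<^esub> x = H +>\<^bsub>M\<^esub> ?y" by (rule someI[of _ x]) (use x in simp)
    then have "x \<ominus>\<^bsub>M\<^esub> ?y \<in> H" using coset_eq_iff x by blast
    then have "f (x \<ominus>\<^bsub>M\<^esub> ?y) \<oplus>\<^bsub>N\<^esub> f ?y = f ?y" using f0 y by simp
    moreover have "f (x \<ominus>\<^bsub>M\<^esub> ?y) \<oplus>\<^bsub>N\<^esub> f ?y = f (x \<ominus>\<^bsub>M\<^esub> ?y \<oplus>\<^bsub>M\<^esub> ?y)"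
      using x y by (simp del: f.f_minus)
    moreover have "x \<ominus>\<^bsub>M\<^esub> ?y \<oplus>\<^bsub>M\<^esub> ?y = x" using x y by (simp add: M.minus_eq M.a_assoc M.l_neg)
    ultimately have "f x = f ?y" by simp
    then show ?thesis using coset_closed[OF x] by (simp add: g_def)
  qed
  have "g \<in> module_hom k (quotient_module M H) N"
    unfolding module_hom_def by (auto elim!: coset_cases simp: coset_add coset_smult g)
  then have "g \<in> Hom k (quotient_module M H) N" by (auto simp: Hom_def g_def)
  then show ?thesis using g by blast
qed

end

section \<open>Tensor powers\<close>

lemma tuples_iff: "xs \<in> tuples X n \<longleftrightarrow> set xs \<subseteq> X \<and> length xs = n"
  by (simp add: tuples_def)

lemma mod_homI: "module k M \<Longrightarrow> module k N \<Longrightarrow> f \<in> module_hom k M N \<Longrightarrow> mod_hom k M N f"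
  by (simp add: mod_hom_def mod_hom_axioms_def)

lemma module_hom_compose:
  assumes "f \<in> module_hom k M N" "g \<in> module_hom k N P"
  shows "(\<lambda>a. g (f a)) \<in> module_hom k M P"
  using assms by (auto simp: module_hom_def Pi_iff)

text \<open>\<open>V\<close> is multilinear on \<open>n\<close>-tuples: linear in each entry, the others being fixed. The first
  conjunct matters only for \<open>n = 0\<close>, where there is no entry.\<close>

definition multilinear ::
    "('k, 'r) ring_scheme \<Rightarrow> ('k, 'a, 'm) module_scheme \<Rightarrow> nat \<Rightarrow> ('k, 'b, 'n) module_scheme \<Rightarrow>
     ('a list \<Rightarrow> 'b) \<Rightarrow> bool" where
  "multilinear k M n N V \<longleftrightarrow>
     V \<in> tuples (carrier M) n \<rightarrow> carrier N \<and>
     (\<forall>xs ys. set xs \<subseteq> carrier M \<and> set ys \<subseteq> carrier M \<and> length xs + length ys + 1 = n \<longrightarrow>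
        (\<lambda>a. V (xs @ a # ys)) \<in> module_hom k M N)"

lemma multilinear_slot:
  assumes "multilinear k M n N V" "set xs \<subseteq> carrier M" "set ys \<subseteq> carrier M"
    "length xs + length ys + 1 = n"
  shows "(\<lambda>a. V (xs @ a # ys)) \<in> module_hom k M N"
  using assms by (auto simp: multilinear_def)

lemma multilinear_closed:
  assumes "multilinear k M n N V" "xs \<in> tuples (carrier M) n"
  shows "V xs \<in> carrier N"
  using assms by (auto simp: multilinear_def)

lemma multilinear_smult:
  assumes "multilinear k M n N V" "set xs \<subseteq> carrier M" "set ys \<subseteq> carrier M"
    "length xs + length ys + 1 = n" "c \<in> carrier k" "a \<in> carrier M"
  shows "V (xs @ (c \<odot>\<^bsub>M\<^esub> a) # ys) = c \<odot>\<^bsub>N\<^esub> V (xs @ a # ys)"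
  using module_hom_smult[OF multilinear_slot[OF assms(1-4)] assms(5,6)] .

lemma multilinear_compose_hom:
  assumes V: "multilinear k M n N V" and f: "f \<in> module_hom k N P"
  shows "multilinear k M n P (\<lambda>as. f (V as))"
  unfolding multilinear_def
proof (intro conjI allI impI)
  show "(\<lambda>as. f (V as)) \<in> tuples (carrier M) n \<rightarrow> carrier P"
    using multilinear_closed[OF V] module_hom_closed[OF f] by blast
  fix xs ys
  assume "set xs \<subseteq> carrier M \<and> set ys \<subseteq> carrier M \<and> length xs + length ys + 1 = n"
  then have "(\<lambda>a. V (xs @ a # ys)) \<in> module_hom k M N" using multilinear_slot[OF V] by blast
  then show "(\<lambda>a. f (V (xs @ a # ys))) \<in> module_hom k M P" using f by (rule module_hom_compose)
qed

lemma list_mult_simps [simp]: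
  "list_mult A [] = \<one>\<^bsub>A\<^esub>" "list_mult A (x # xs) = x \<otimes>\<^bsub>A\<^esub> list_mult A xs"
  by (simp_all add: list_mult_def)

context module
begin

lemma module_tuple_module: "module R (tuple_module R M n)"
  unfolding tuple_module_def by (rule module_free_module) (rule R.is_cring)

lemma single_tuple_closed: "as \<in> tuples (carrier M) n \<Longrightarrow> single R as \<in> carrier (tuple_module R M n)"
  unfolding tuple_module_def by (rule single_closed[OF R.is_cring])

lemma multilinearity_relations_closed:
  "multilinearity_relations R M n \<subseteq> carrier (tuple_module R M n)"
proof -
  interpret F: module R "tuple_module R M n" by (rule module_tuple_module)
  show ?thesis
    unfolding multilinearity_relations_def Let_def
    by (intro Un_least subsetI; elim CollectE exE conjE; hypsubst;
        intro F.M.minus_closed F.smult_closed F.M.a_closed single_tuple_closed)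
      (auto simp: tuples_iff)
qed

lemma submodule_multilinearity_submodule:
  "LinearCombinations.submodule R (multilinearity_submodule R M n) (tuple_module R M n)"
  unfolding multilinearity_submodule_def
  by (rule module.span_is_submodule[OF module_tuple_module multilinearity_relations_closed])

lemma module_tensor_power: "module R (tensor_power R M n)"
  unfolding tensor_power_def by (rule module_quotient_module[OF submodule_multilinearity_submodule])

lemma pure_eq:
  "length as = n \<Longrightarrow>
     pure R M as = multilinearity_submodule R M n +>\<^bsub>tuple_module R M n\<^esub> single R as"
  by (auto simp: pure_def)

lemma pure_closed:
  assumes "as \<in> tuples (carrier M) n"
  shows "pure R M as \<in> carrier (tensor_power R M n)"
  using coset_closed[OF submodule_multilinearity_submodule single_tuple_closed[OF assms]]
    pure_eq[of as n] assms by (simp add: tuples_def tensor_power_def)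

lemma multilinear_pure: "multilinear R M n (tensor_power R M n) (pure R M)"
  unfolding multilinear_def
proof (intro conjI allI impI)
  show "pure R M \<in> tuples (carrier M) n \<rightarrow> carrier (tensor_power R M n)"
    using pure_closed by blast
  fix xs ys
  assume "set xs \<subseteq> carrier M \<and> set ys \<subseteq> carrier M \<and> length xs + length ys + 1 = n"
  then have tup: "xs @ a # ys \<in> tuples (carrier M) n" if "a \<in> carrier M" for a
    using that by (auto simp: tuples_iff)
  interpret F: module R "tuple_module R M n" by (rule module_tuple_module)
  note sub = submodule_multilinearity_submodule[of n]
  note sgl = single_tuple_closed[OF tup]
  let ?F = "tuple_module R M n" and ?H = "multilinearity_submodule R M n"
  have rel: "r \<in> ?H" if "r \<in> multilinearity_relations R M n" for r
    using F.in_own_span[OF multilinearity_relations_closed] that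
    unfolding multilinearity_submodule_def by blast
  have pure: "pure R M (xs @ a # ys) = ?H +>\<^bsub>?F\<^esub> single R (xs @ a # ys)"
    if "a \<in> carrier M" for a using tup[OF that] by (intro pure_eq) (simp add: tuples_iff)
  show "(\<lambda>a. pure R M (xs @ a # ys)) \<in> module_hom R M (tensor_power R M n)"
    unfolding module_hom_def
  proof (intro CollectI conjI allI impI)
    show "(\<lambda>a. pure R M (xs @ a # ys)) \<in> carrier M \<rightarrow> carrier (tensor_power R M n)"
      using tup pure_closed by blast
    fix a b assume "a \<in> carrier M \<and> b \<in> carrier M"
    then have a: "a \<in> carrier M" and b: "b \<in> carrier M" by auto
    have "single R (xs @ [a \<oplus>\<^bsub>M\<^esub> b] @ ys) \<ominus>\<^bsub>?F\<^esub>
        (single R (xs @ [a] @ ys) \<oplus>\<^bsub>?F\<^esub> single R (xs @ [b] @ ys)) \<in> ?H"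
      by (rule rel) (use tup[OF a] b in \<open>force simp: multilinearity_relations_def Let_def\<close>)
    then show "pure R M (xs @ (a \<oplus>\<^bsub>M\<^esub> b) # ys) =
        pure R M (xs @ a # ys) \<oplus>\<^bsub>tensor_power R M n\<^esub> pure R M (xs @ b # ys)"
      unfolding tensor_power_def using a b sgl
      by (simp add: pure coset_add[OF sub] coset_eq_iff[OF sub])
  next
    fix c a assume "c \<in> carrier R \<and> a \<in> carrier M"
    then have c: "c \<in> carrier R" and a: "a \<in> carrier M" by auto
    have "single R (xs @ [c \<odot>\<^bsub>M\<^esub> a] @ ys) \<ominus>\<^bsub>?F\<^esub> c \<odot>\<^bsub>?F\<^esub> single R (xs @ [a] @ ys) \<in> ?H"
      by (rule rel) (use tup[OF a] c in \<open>force simp: multilinearity_relations_def Let_def\<close>)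
    then show "pure R M (xs @ (c \<odot>\<^bsub>M\<^esub> a) # ys) = c \<odot>\<^bsub>tensor_power R M n\<^esub> pure R M (xs @ a # ys)"
      unfolding tensor_power_def using a c sgl
      by (simp add: pure coset_smult[OF sub] coset_eq_iff[OF sub])
  qed
qed

text \<open>The universal property of the tensor power: existence and uniqueness.\<close>

lemma tensor_power_lift:
  assumes N: "module R N" and V: "multilinear R M n N V"
  shows "\<exists>f \<in> Hom R (tensor_power R M n) N. \<forall>as \<in> tuples (carrier M) n. f (pure R M as) = V as"
proof -
  interpret F: module R "tuple_module R M n" by (rule module_tuple_module)
  let ?F = "tuple_module R M n"
  have Vc: "V \<in> tuples (carrier M) n \<rightarrow> carrier N" using V by (simp add: multilinear_def)
  have hom: "free_ext R N V \<in> module_hom R ?F N"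
    unfolding tuple_module_def by (rule free_ext_hom[OF N Vc])
  interpret N: module R N by (rule N)
  interpret E: mod_hom R ?F N "free_ext R N V"
    by (rule mod_homI[OF module_tuple_module N hom])
  have E_single: "free_ext R N V (single R as) = V as" if "as \<in> tuples (carrier M) n" for as
    by (rule free_ext_single[OF N Vc that])
  have "free_ext R N V r = \<zero>\<^bsub>N\<^esub>" if "r \<in> multilinearity_relations R M n" for r
    using that unfolding multilinearity_relations_def Let_def
  proof (elim UnE CollectE exE conjE)
    fix xs ys a b
    assume r: "r = single R (xs @ [a \<oplus>\<^bsub>M\<^esub> b] @ ys) \<ominus>\<^bsub>?F\<^esub>
        (single R (xs @ [a] @ ys) \<oplus>\<^bsub>?F\<^esub> single R (xs @ [b] @ ys))"
      and a: "xs @ [a] @ ys \<in> tuples (carrier M) n" and b: "b \<in> carrier M"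
    have tup: "xs @ [x] @ ys \<in> tuples (carrier M) n" if "x \<in> carrier M" for x
      using a that by (auto simp: tuples_iff)
    have ac: "a \<in> carrier M" using a by (auto simp: tuples_iff)
    have "(\<lambda>a. V (xs @ a # ys)) \<in> module_hom R M N"
      by (rule multilinear_slot[OF V]) (use a in \<open>auto simp: tuples_iff\<close>)
    then have "V (xs @ (a \<oplus>\<^bsub>M\<^esub> b) # ys) = V (xs @ a # ys) \<oplus>\<^bsub>N\<^esub> V (xs @ b # ys)"
      using module_hom_add ac b by fastforce
    then show "free_ext R N V r = \<zero>\<^bsub>N\<^esub>"
      unfolding r using E_single[OF tup] multilinear_closed[OF V tup] single_tuple_closed[OF tup] ac b
      by (simp add: N.M.minus_eq N.M.r_neg)
  next
    fix xs ys a c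
    assume r: "r = single R (xs @ [c \<odot>\<^bsub>M\<^esub> a] @ ys) \<ominus>\<^bsub>?F\<^esub> c \<odot>\<^bsub>?F\<^esub> single R (xs @ [a] @ ys)"
      and a: "xs @ [a] @ ys \<in> tuples (carrier M) n" and c: "c \<in> carrier R"
    have tup: "xs @ [x] @ ys \<in> tuples (carrier M) n" if "x \<in> carrier M" for x
      using a that by (auto simp: tuples_iff)
    have ac: "a \<in> carrier M" using a by (auto simp: tuples_iff)
    have "V (xs @ (c \<odot>\<^bsub>M\<^esub> a) # ys) = c \<odot>\<^bsub>N\<^esub> V (xs @ a # ys)"
      by (rule multilinear_smult[OF V]) (use a c in \<open>auto simp: tuples_iff\<close>)
    then show "free_ext R N V r = \<zero>\<^bsub>N\<^esub>"
      unfolding r using E_single[OF tup] multilinear_closed[OF V tup] single_tuple_closed[OF tup] ac c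
      by (simp add: N.M.minus_eq N.M.r_neg)
  qed
  then have "multilinearity_relations R M n \<subseteq> E.ker"
    using multilinearity_relations_closed by (auto simp: E.ker_def)
  then have "multilinearity_submodule R M n \<subseteq> E.ker"
    unfolding multilinearity_submodule_def by (rule F.span_is_subset) (rule E.ker_is_submodule)
  then have "\<exists>g \<in> Hom R (tensor_power R M n) N. \<forall>x \<in> carrier ?F.
      g (multilinearity_submodule R M n +>\<^bsub>?F\<^esub> x) = free_ext R N V x"
    unfolding tensor_power_def
    by (intro quotient_module_lift[OF submodule_multilinearity_submodule N hom])
       (auto simp: E.ker_def)
  then obtain g where g: "g \<in> Hom R (tensor_power R M n) N"
    "\<And>x. x \<in> carrier ?F \<Longrightarrow> g (multilinearity_submodule R M n +>\<^bsub>?F\<^esub> x) = free_ext R N V x"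
    by blast
  then have "g (pure R M as) = V as" if "as \<in> tuples (carrier M) n" for as
    using pure_eq[of as n] E_single[OF that] single_tuple_closed[OF that] that
    by (simp add: tuples_iff)
  then show ?thesis using g(1) by blast
qed

lemma Hom_tensor_power_eqI:
  assumes N: "module R N" and f: "f \<in> Hom R (tensor_power R M n) N"
    and g: "g \<in> Hom R (tensor_power R M n) N"
    and eq: "\<And>as. as \<in> tuples (carrier M) n \<Longrightarrow> f (pure R M as) = g (pure R M as)"
  shows "f = g"
proof (rule extensionalityI)
  let ?F = "tuple_module R M n" and ?H = "multilinearity_submodule R M n"
  note sub = submodule_multilinearity_submodule[of n]
  interpret F: module R ?F by (rule module_tuple_module)
  interpret T: module R "tensor_power R M n" by (rule module_tensor_power)
  interpret f: mod_hom R "tensor_power R M n" N f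
    by (rule mod_homI[OF module_tensor_power N]) (use f in \<open>simp add: Hom_def\<close>)
  interpret g: mod_hom R "tensor_power R M n" N g
    by (rule mod_homI[OF module_tensor_power N]) (use g in \<open>simp add: Hom_def\<close>)
  show "f \<in> extensional (carrier (tensor_power R M n))"
    "g \<in> extensional (carrier (tensor_power R M n))" using f g by (auto simp: Hom_def)
  fix X assume "X \<in> carrier (tensor_power R M n)"
  then obtain x where x: "x \<in> carrier ?F" and X: "X = ?H +>\<^bsub>?F\<^esub> x"
    unfolding tensor_power_def by (rule coset_cases[OF sub])
  have "f (?H +>\<^bsub>?F\<^esub> x) = g (?H +>\<^bsub>?F\<^esub> x)"
    using R.is_cring x unfolding tuple_module_def
  proof (induction rule: free_module_induct)
    case zero
    have "?H +>\<^bsub>?F\<^esub> \<zero>\<^bsub>?F\<^esub> = \<zero>\<^bsub>tensor_power R M n\<^esub>"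
      unfolding tensor_power_def quotient_module_simps
      using abelian_subgroup.a_rcos_const[OF abelian_subgroup_submodule[OF sub]]
        LinearCombinations.submodule.zero_closed[OF sub] by simp
    then show ?case by (simp add: tuple_module_def)
  next
    case (add_smult_single c as y)
    let ?s = "?H +>\<^bsub>?F\<^esub> single R as" and ?y = "?H +>\<^bsub>?F\<^esub> y"
    have y: "y \<in> carrier ?F" using add_smult_single by (simp add: tuple_module_def)
    note s = single_tuple_closed[OF add_smult_single(2)]
    have "?H +>\<^bsub>?F\<^esub> (c \<odot>\<^bsub>?F\<^esub> single R as \<oplus>\<^bsub>?F\<^esub> y)
        = c \<odot>\<^bsub>tensor_power R M n\<^esub> ?s \<oplus>\<^bsub>tensor_power R M n\<^esub> ?y"
      unfolding tensor_power_def using y s add_smult_single(1)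
      by (simp add: coset_add[OF sub] coset_smult[OF sub])
    moreover have "?y \<in> carrier (tensor_power R M n)" "?s \<in> carrier (tensor_power R M n)"
      unfolding tensor_power_def using y s coset_closed[OF sub] by auto
    moreover have "f ?s = g ?s"
      using eq[OF add_smult_single(2)] pure_eq[of as n] add_smult_single(2) by (simp add: tuples_iff)
    moreover have "f ?y = g ?y" using add_smult_single(4) by (simp add: tuple_module_def)
    ultimately show ?case using add_smult_single(1) by (simp flip: tuple_module_def)
  qed
  then show "f X = g X" using X by simp
qed

lemma multilinear_Hom_pure:
  "f \<in> Hom R (tensor_power R M n) N \<Longrightarrow> multilinear R M n N (\<lambda>as. f (pure R M as))"
  by (rule multilinear_compose_hom[OF multilinear_pure]) (simp add: Hom_def)

text \<open>Scalars attached to the entries from \<open>as\<close> can be pulled out as their product.\<close>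

lemma multilinear_map2_smult:
  assumes V: "multilinear R M n N V" and N: "module R N"
    and "length cs = length as" "set cs \<subseteq> carrier R" "set as \<subseteq> carrier M" "set us \<subseteq> carrier M"
    "length us + length as = n"
  shows "V (us @ map2 (smult M) cs as) = list_mult R cs \<odot>\<^bsub>N\<^esub> V (us @ as)"
  using assms(3-)
proof (induction cs as arbitrary: us rule: list_induct2)
  case Nil
  then have "V us \<in> carrier N" using multilinear_closed[OF V, of us] by (simp add: tuples_iff)
  then show ?case by (simp add: module.smult_one[OF N])
next
  case (Cons c cs a as)
  have cs: "list_mult R cs \<in> carrier R" using Cons.prems(1) by (induction cs) auto
  have sm: "set (map2 (smult M) cs as) \<subseteq> carrier M"
    using Cons.prems by (fastforce dest: set_zip_leftD set_zip_rightD)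
  have "V (us @ map2 (smult M) (c # cs) (a # as)) = c \<odot>\<^bsub>N\<^esub> V ((us @ [a]) @ map2 (smult M) cs as)"
    using multilinear_smult[OF V, of us "map2 (smult M) cs as" c a] Cons.prems Cons.hyps sm by simp
  also have "V ((us @ [a]) @ map2 (smult M) cs as) = list_mult R cs \<odot>\<^bsub>N\<^esub> V ((us @ [a]) @ as)"
    using Cons.prems by (intro Cons.IH) auto
  also have "c \<odot>\<^bsub>N\<^esub> (list_mult R cs \<odot>\<^bsub>N\<^esub> V ((us @ [a]) @ as)) = list_mult R (c # cs) \<odot>\<^bsub>N\<^esub> V (us @ a # as)"
    using Cons.prems cs multilinear_closed[OF V, of "us @ a # as"]
    by (simp add: module.smult_assoc1[OF N] tuples_iff)
  finally show ?case .
qed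

text \<open>A multilinear map is determined by its values on tuples from a generating set.\<close>

lemma multilinear_eqI:
  assumes N: "module R N" and V: "multilinear R M n N V" and W: "multilinear R M n N W"
    and B: "B \<subseteq> carrier M" "span B = carrier M"
    and eq: "\<And>bs. bs \<in> tuples B n \<Longrightarrow> V bs = W bs"
    and as: "as \<in> tuples (carrier M) n"
  shows "V as = W as"
proof -
  interpret N: module R N by (rule N)
  \<comment> \<open>the entries in \<open>B\<close> are replaced by arbitrary ones from the left, one at a time\<close>
  have "V (xs @ ys) = W (xs @ ys)"
    if "set xs \<subseteq> carrier M" "set ys \<subseteq> B" "length xs + length ys = n" for xs ys
    using that
  proof (induction xs arbitrary: ys rule: rev_induct)
    case Nil
    then show ?case using eq[of ys] by (simp add: tuples_iff)
  next
    case (snoc x xs)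
    have slots: "(\<lambda>a. V (xs @ a # ys)) \<in> module_hom R M N" "(\<lambda>a. W (xs @ a # ys)) \<in> module_hom R M N"
      using snoc.prems B(1) by (auto intro!: multilinear_slot[OF V] multilinear_slot[OF W])
    interpret f: mod_hom R M N "\<lambda>a. V (xs @ a # ys)" by (rule mod_homI[OF module_axioms N slots(1)])
    interpret g: mod_hom R M N "\<lambda>a. W (xs @ a # ys)" by (rule mod_homI[OF module_axioms N slots(2)])
    let ?E = "{a \<in> carrier M. V (xs @ a # ys) = W (xs @ a # ys)}"
    have "LinearCombinations.submodule R ?E M"
      by (rule LinearCombinations.submodule.intro[OF module_axioms])
         (use f.f_add g.f_add f.f_smult g.f_smult f.f0_is_0 g.f0_is_0 in auto)
    moreover have "B \<subseteq> ?E"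
    proof
      fix b assume b: "b \<in> B"
      have "V (xs @ b # ys) = W (xs @ b # ys)" using snoc.prems b by (intro snoc.IH) auto
      then show "b \<in> ?E" using b B(1) by auto
    qed
    ultimately have "span B \<subseteq> ?E" using span_is_subset by blast
    then show ?case using B(2) snoc.prems(1) by auto
  qed
  from this[of as "[]"] as show ?thesis by (simp add: tuples_iff)
qed

end

section \<open>Tensor powers of a module with a basis\<close>

text \<open>The coordinates of \<open>a\<close> with respect to the basis \<open>B\<close>, as an element of the free module on
  \<open>B\<close>: the coordinate function vanishes outside \<open>B\<close>.\<close>

definition coord ::
    "('k, 'r) ring_scheme \<Rightarrow> ('k, 'a, 'm) module_scheme \<Rightarrow> 'a set \<Rightarrow> 'a \<Rightarrow> 'a \<Rightarrow> 'k" where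
  "coord k M B a = (THE c. c \<in> carrier (free_module k B) \<and> free_ext k M (\<lambda>b. b) c = a)"

text \<open>The multilinear extension of a function \<open>v\<close> on tuples of basis elements, one entry at a
  time.\<close>

primrec multilinear_ext ::
    "('k, 'r) ring_scheme \<Rightarrow> ('k, 'a, 'm) module_scheme \<Rightarrow> 'a set \<Rightarrow> ('k, 'b, 'n) module_scheme \<Rightarrow>
     'a list \<Rightarrow> ('a list \<Rightarrow> 'b) \<Rightarrow> 'b" where
  "multilinear_ext k M B N [] = (\<lambda>v. v [])"
| "multilinear_ext k M B N (a # as) =
     (\<lambda>v. free_ext k N (\<lambda>b. multilinear_ext k M B N as (\<lambda>bs. v (b # bs))) (coord k M B a))"

context module
begin

context
  fixes B
  assumes basis: "module_basis R M B"
begin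

lemma basis_closed: "B \<subseteq> carrier M" and basis_span: "span B = carrier M"
  and basis_indep: "lin_indpt B"
  using basis by (simp_all add: module_basis_def)

lemma coord_unique:
  assumes a: "a \<in> carrier M"
  shows "\<exists>!c. c \<in> carrier (free_module R B) \<and> free_ext R M (\<lambda>b. b) c = a"
proof -
  interpret F: module R "free_module R B" by (rule module_free_module[OF R.is_cring])
  have id: "(\<lambda>b. b) \<in> B \<rightarrow> carrier M" using basis_closed by auto
  interpret E: mod_hom R "free_module R B" M "free_ext R M (\<lambda>b. b)"
    by (rule mod_homI[OF F.module_axioms module_axioms free_ext_hom[OF module_axioms id]])
  have "a \<in> span B" using a basis_span by simp
  then obtain c A where A: "finite A" "A \<subseteq> B" "c \<in> A \<rightarrow> carrier R" "a = lincomb c A"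
    by (auto simp: span_def)
  let ?c = "\<lambda>x. if x \<in> A then c x else \<zero>\<^bsub>R\<^esub>"
  have "finite {x. ?c x \<noteq> \<zero>\<^bsub>R\<^esub>}" by (rule finite_subset[OF _ A(1)]) auto
  then have c: "?c \<in> carrier (free_module R B)" using A(2,3) by auto
  have "free_ext R M (\<lambda>b. b) ?c = (\<Oplus>\<^bsub>M\<^esub> x \<in> A. ?c x \<odot>\<^bsub>M\<^esub> x)"
    by (rule free_ext_eq[OF module_axioms c id A(1) _ A(2)]) auto
  also have "\<dots> = a"
    unfolding A(4) lincomb_def using A(2,3) basis_closed by (intro finsum_cong') (auto intro!: smult_closed)
  finally have ex: "free_ext R M (\<lambda>b. b) ?c = a" .
  have "d = e" if de: "d \<in> carrier (free_module R B)" "e \<in> carrier (free_module R B)"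
    and eq: "free_ext R M (\<lambda>b. b) d = free_ext R M (\<lambda>b. b) e" for d e
  proof -
    let ?d = "d \<ominus>\<^bsub>free_module R B\<^esub> e"
    have d: "?d \<in> carrier (free_module R B)" using de by (rule F.M.minus_closed)
    have zero: "free_ext R M (\<lambda>b. b) ?d = \<zero>\<^bsub>M\<^esub>"
      using E.f_minus[OF de] eq E.f_im[OF de(2)] by (simp add: M.minus_eq M.r_neg)
    have "?d x = \<zero>\<^bsub>R\<^esub>" for x
    proof (rule ccontr)
      assume x: "?d x \<noteq> \<zero>\<^bsub>R\<^esub>"
      have "lin_dep B"
      proof (rule lin_dep_crit)
        show "finite {x. ?d x \<noteq> \<zero>\<^bsub>R\<^esub>}" "{x. ?d x \<noteq> \<zero>\<^bsub>R\<^esub>} \<subseteq> B" using d by auto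
        show "?d \<in> {x. ?d x \<noteq> \<zero>\<^bsub>R\<^esub>} \<rightarrow> carrier R"
          using free_module_in_ring[OF R.is_cring d] by auto
        show "x \<in> {x. ?d x \<noteq> \<zero>\<^bsub>R\<^esub>}" "?d x \<noteq> \<zero>\<^bsub>R\<^esub>" using x by auto
        show "lincomb ?d {x. ?d x \<noteq> \<zero>\<^bsub>R\<^esub>} = \<zero>\<^bsub>M\<^esub>"
          using zero by (simp add: lincomb_def free_ext_def)
      qed
      then show False using basis_indep by simp
    qed
    then have "?d = \<zero>\<^bsub>free_module R B\<^esub>" by auto
    then have "?d \<oplus>\<^bsub>free_module R B\<^esub> e = e" using de by (simp del: free_module_simps)
    moreover have "?d \<oplus>\<^bsub>free_module R B\<^esub> e = d"
      using de by (simp add: F.M.minus_eq F.M.a_assoc F.M.l_neg del: free_module_simps)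
    ultimately show ?thesis by simp
  qed
  then show ?thesis using c ex by (intro ex1I[of _ ?c]) auto
qed

lemma coord_closed: "a \<in> carrier M \<Longrightarrow> coord R M B a \<in> carrier (free_module R B)"
  and free_ext_coord: "a \<in> carrier M \<Longrightarrow> free_ext R M (\<lambda>b. b) (coord R M B a) = a"
  using theI'[OF coord_unique] unfolding coord_def by auto

lemma coord_eqI:
  "c \<in> carrier (free_module R B) \<Longrightarrow> free_ext R M (\<lambda>b. b) c = a \<Longrightarrow> a \<in> carrier M \<Longrightarrow> coord R M B a = c"
  unfolding coord_def using the1_equality[OF coord_unique] by blast

lemma coord_basis: "b \<in> B \<Longrightarrow> coord R M B b = single R b"
  using basis_closed
  by (intro coord_eqI single_closed[OF R.is_cring] free_ext_single[OF module_axioms, of _ B]) auto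

lemma coord_hom: "coord R M B \<in> module_hom R M (free_module R B)"
proof -
  interpret F: module R "free_module R B" by (rule module_free_module[OF R.is_cring])
  have "(\<lambda>b. b) \<in> B \<rightarrow> carrier M" using basis_closed by auto
  then interpret E: mod_hom R "free_module R B" M "free_ext R M (\<lambda>b. b)"
    by (intro mod_homI[OF F.module_axioms module_axioms free_ext_hom[OF module_axioms]])
  show ?thesis
    unfolding module_hom_def
  proof (intro CollectI conjI allI impI)
    show "coord R M B \<in> carrier M \<rightarrow> carrier (free_module R B)" using coord_closed by blast
    show "coord R M B (a \<oplus>\<^bsub>M\<^esub> b) = coord R M B a \<oplus>\<^bsub>free_module R B\<^esub> coord R M B b"
      if "a \<in> carrier M \<and> b \<in> carrier M" for a b
      by (rule coord_eqI[OF F.M.a_closed])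
         (use that coord_closed free_ext_coord E.f_add in \<open>simp_all del: free_module_simps\<close>)
    show "coord R M B (c \<odot>\<^bsub>M\<^esub> a) = c \<odot>\<^bsub>free_module R B\<^esub> coord R M B a"
      if "c \<in> carrier R \<and> a \<in> carrier M" for c a
      by (rule coord_eqI[OF F.smult_closed])
         (use that coord_closed free_ext_coord E.f_smult in \<open>simp_all del: free_module_simps\<close>)
  qed
qed

lemma multilinear_ext_closed:
  assumes N: "module R N" and "set as \<subseteq> carrier M" "v \<in> tuples B (length as) \<rightarrow> carrier N"
  shows "multilinear_ext R M B N as v \<in> carrier N"
  using assms(2-)
proof (induction as arbitrary: v)
  case Nil
  then show ?case by (auto simp: tuples_iff)
next
  case (Cons a as)
  have "(\<lambda>b. multilinear_ext R M B N as (\<lambda>bs. v (b # bs))) \<in> B \<rightarrow> carrier N"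
    using Cons.prems by (auto intro!: Cons.IH simp: tuples_iff Pi_iff)
  from funcset_mem[OF module_hom_closed[OF free_ext_hom[OF N this]] coord_closed] Cons.prems(1)
  show ?case by simp
qed

lemma multilinear_ext_slot:
  assumes N: "module R N" and "set xs \<subseteq> carrier M" and ys: "set ys \<subseteq> carrier M"
    and "v \<in> tuples B (length xs + length ys + 1) \<rightarrow> carrier N"
  shows "(\<lambda>a. multilinear_ext R M B N (xs @ a # ys) v) \<in> module_hom R M N"
  using assms(2,4)
proof (induction xs arbitrary: v)
  case Nil
  have "(\<lambda>b. multilinear_ext R M B N ys (\<lambda>bs. v (b # bs))) \<in> B \<rightarrow> carrier N"
    using Nil.prems ys by (auto intro!: multilinear_ext_closed[OF N] simp: tuples_iff Pi_iff)
  then show ?case using module_hom_compose[OF coord_hom free_ext_hom[OF N]] by simp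
next
  case (Cons x xs)
  show ?case unfolding append_Cons multilinear_ext.simps
  proof (rule free_ext_arg_hom[OF module_axioms N coord_closed])
    show "x \<in> carrier M" using Cons.prems(1) by simp
    show "(\<lambda>a. multilinear_ext R M B N (xs @ a # ys) (\<lambda>bs. v (b # bs))) \<in> module_hom R M N"
      if "b \<in> B" for b
      using Cons.prems that by (intro Cons.IH) (auto simp: tuples_iff Pi_iff)
  qed
qed

lemma multilinear_ext_basis:
  assumes N: "module R N" and "bs \<in> tuples B n" "v \<in> tuples B n \<rightarrow> carrier N"
  shows "multilinear_ext R M B N bs v = v bs"
  using assms(2-)
proof (induction bs arbitrary: v n)
  case (Cons b bs)
  have w: "(\<lambda>b. multilinear_ext R M B N bs (\<lambda>bs. v (b # bs))) \<in> B \<rightarrow> carrier N"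
    using Cons.prems basis_closed
    by (auto intro!: multilinear_ext_closed[OF N] simp: tuples_iff Pi_iff)
  have "multilinear_ext R M B N (b # bs) v = multilinear_ext R M B N bs (\<lambda>bs. v (b # bs))"
    using Cons.prems(1) free_ext_single[OF N w] by (simp add: coord_basis tuples_iff)
  also have "\<dots> = v (b # bs)"
    using Cons.prems by (intro Cons.IH[of "length bs"]) (auto simp: tuples_iff Pi_iff)
  finally show ?case .
qed simp

lemma multilinear_multilinear_ext:
  assumes N: "module R N" and v: "v \<in> tuples B n \<rightarrow> carrier N"
  shows "multilinear R M n N (\<lambda>as. multilinear_ext R M B N as v)"
  unfolding multilinear_def
  using multilinear_ext_closed[OF N] multilinear_ext_slot[OF N] v by (auto simp: tuples_iff)

lemma Hom_tensor_power_basis_eqI: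
  assumes N: "module R N" and f: "f \<in> Hom R (tensor_power R M n) N"
    and g: "g \<in> Hom R (tensor_power R M n) N"
    and eq: "\<And>bs. bs \<in> tuples B n \<Longrightarrow> f (pure R M bs) = g (pure R M bs)"
  shows "f = g"
  by (rule Hom_tensor_power_eqI[OF N f g],
      rule multilinear_eqI[OF N multilinear_Hom_pure[OF f] multilinear_Hom_pure[OF g]
        basis_closed basis_span eq])

text \<open>If \<open>B\<close> is a basis, arbitrary values on the tensors of basis elements do determine a linear map,
  so the definite description in \<^const>\<open>tensor_map\<close> is proper; similarly below for multilinear values on
  all pure tensors.\<close>

lemma tensor_map_basis:
  assumes N: "module R N" and v: "v \<in> tuples B n \<rightarrow> carrier N"
  shows tensor_map_basis_Hom: "tensor_map R M B n N v \<in> Hom R (tensor_power R M n) N"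
    and tensor_map_basis_pure: "\<And>bs. bs \<in> tuples B n \<Longrightarrow> tensor_map R M B n N v (pure R M bs) = v bs"
proof -
  obtain f where f: "f \<in> Hom R (tensor_power R M n) N"
    "\<And>as. as \<in> tuples (carrier M) n \<Longrightarrow> f (pure R M as) = multilinear_ext R M B N as v"
    using tensor_power_lift[OF N multilinear_multilinear_ext[OF N v]] by blast
  have "f (pure R M bs) = v bs" if "bs \<in> tuples B n" for bs
    using f(2)[of bs] multilinear_ext_basis[OF N that v] that basis_closed by (auto simp: tuples_iff)
  then have "\<exists>!f. f \<in> Hom R (tensor_power R M n) N \<and> (\<forall>xs \<in> tuples B n. f (pure R M xs) = v xs)"
    using f(1) Hom_tensor_power_basis_eqI[OF N] by (intro ex1I[of _ f]) auto
  from theI'[OF this]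
  show "tensor_map R M B n N v \<in> Hom R (tensor_power R M n) N"
    "\<And>bs. bs \<in> tuples B n \<Longrightarrow> tensor_map R M B n N v (pure R M bs) = v bs"
    unfolding tensor_map_def by blast+
qed

end

lemma tensor_map_multilinear:
  assumes N: "module R N" and V: "multilinear R M n N V"
  shows tensor_map_multilinear_Hom: "tensor_map R M (carrier M) n N V \<in> Hom R (tensor_power R M n) N"
    and tensor_map_multilinear_pure: "\<And>as. as \<in> tuples (carrier M) n \<Longrightarrow>
      tensor_map R M (carrier M) n N V (pure R M as) = V as"
proof -
  have "\<exists>!f. f \<in> Hom R (tensor_power R M n) N \<and>
      (\<forall>xs \<in> tuples (carrier M) n. f (pure R M xs) = V xs)"
    using tensor_power_lift[OF N V] Hom_tensor_power_eqI[OF N] by (metis (no_types, lifting))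
  from theI'[OF this]
  show "tensor_map R M (carrier M) n N V \<in> Hom R (tensor_power R M n) N"
    "\<And>as. as \<in> tuples (carrier M) n \<Longrightarrow> tensor_map R M (carrier M) n N V (pure R M as) = V as"
    unfolding tensor_map_def by blast+
qed

end

section \<open>Sums and insertions of linear maps\<close>

lemma module_self_module:
  assumes "cring k"
  shows "module k (self_module k)"
proof -
  interpret cring k by fact
  have "abelian_group (self_module k)"
    by (rule abelian_groupI) (auto simp: self_module_def a_ac intro: bexI[of _ "\<ominus>\<^bsub>k\<^esub> _"] l_neg)
  then show ?thesis
    by (rule moduleI[OF assms]) (auto simp: self_module_def l_distr r_distr m_assoc)
qed

lemma (in module) finsum_smult_rdistr:
  assumes "finite S" "f \<in> S \<rightarrow> carrier R" "x \<in> carrier M"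
  shows "(\<Oplus>\<^bsub>R\<^esub> i \<in> S. f i) \<odot>\<^bsub>M\<^esub> x = (\<Oplus>\<^bsub>M\<^esub> i \<in> S. f i \<odot>\<^bsub>M\<^esub> x)"
  using assms(1,2)
proof (induction rule: finite_induct)
  case (insert i S)
  then have "f \<in> S \<rightarrow> carrier R" "f i \<in> carrier R" by auto
  then show ?case using insert assms(3) by (simp add: smult_l_distr Pi_iff)
qed (simp add: assms(3))

lemma (in module) Hom_linear_combination:
  assumes N: "module R N" and "finite S" and s: "s \<in> S \<rightarrow> carrier R"
    and h: "\<And>j. j \<in> S \<Longrightarrow> h j \<in> Hom R M N"
  shows "(\<lambda>x \<in> carrier M. \<Oplus>\<^bsub>N\<^esub> j \<in> S. s j \<odot>\<^bsub>N\<^esub> h j x) \<in> Hom R M N"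
proof -
  interpret N: module R N by (rule N)
  have hc: "h j x \<in> carrier N" if "j \<in> S" "x \<in> carrier M" for j x
    using h[OF that(1)] that(2) by (auto simp: Hom_def module_hom_def)
  have hom: "h j \<in> module_hom R M N" if "j \<in> S" for j using h[OF that] by (simp add: Hom_def)
  have sc: "s j \<in> carrier R" if "j \<in> S" for j using s that by auto
  have add: "(\<Oplus>\<^bsub>N\<^esub> j \<in> S. s j \<odot>\<^bsub>N\<^esub> h j (x \<oplus>\<^bsub>M\<^esub> y)) =
      (\<Oplus>\<^bsub>N\<^esub> j \<in> S. s j \<odot>\<^bsub>N\<^esub> h j x) \<oplus>\<^bsub>N\<^esub> (\<Oplus>\<^bsub>N\<^esub> j \<in> S. s j \<odot>\<^bsub>N\<^esub> h j y)"
    if xy: "x \<in> carrier M" "y \<in> carrier M" for x y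
  proof -
    have "(\<Oplus>\<^bsub>N\<^esub> j \<in> S. s j \<odot>\<^bsub>N\<^esub> h j (x \<oplus>\<^bsub>M\<^esub> y)) =
        (\<Oplus>\<^bsub>N\<^esub> j \<in> S. s j \<odot>\<^bsub>N\<^esub> h j x \<oplus>\<^bsub>N\<^esub> s j \<odot>\<^bsub>N\<^esub> h j y)"
    proof (rule N.finsum_cong')
      fix j assume j: "j \<in> S"
      then have "h j (x \<oplus>\<^bsub>M\<^esub> y) = h j x \<oplus>\<^bsub>N\<^esub> h j y"
        using module_hom_add[OF hom] xy by blast
      then show "s j \<odot>\<^bsub>N\<^esub> h j (x \<oplus>\<^bsub>M\<^esub> y) = s j \<odot>\<^bsub>N\<^esub> h j x \<oplus>\<^bsub>N\<^esub> s j \<odot>\<^bsub>N\<^esub> h j y"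
        using hc[OF j] sc[OF j] xy by (simp add: N.smult_r_distr)
    qed (use hc sc xy in auto)
    also have "\<dots> = (\<Oplus>\<^bsub>N\<^esub> j \<in> S. s j \<odot>\<^bsub>N\<^esub> h j x) \<oplus>\<^bsub>N\<^esub> (\<Oplus>\<^bsub>N\<^esub> j \<in> S. s j \<odot>\<^bsub>N\<^esub> h j y)"
      using hc sc xy by (intro N.finsum_addf) auto
    finally show ?thesis .
  qed
  have smult: "(\<Oplus>\<^bsub>N\<^esub> j \<in> S. s j \<odot>\<^bsub>N\<^esub> h j (c \<odot>\<^bsub>M\<^esub> x)) = c \<odot>\<^bsub>N\<^esub> (\<Oplus>\<^bsub>N\<^esub> j \<in> S. s j \<odot>\<^bsub>N\<^esub> h j x)"
    if c: "c \<in> carrier R" and x: "x \<in> carrier M" for c x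
  proof -
    have "(\<Oplus>\<^bsub>N\<^esub> j \<in> S. s j \<odot>\<^bsub>N\<^esub> h j (c \<odot>\<^bsub>M\<^esub> x)) = (\<Oplus>\<^bsub>N\<^esub> j \<in> S. c \<odot>\<^bsub>N\<^esub> (s j \<odot>\<^bsub>N\<^esub> h j x))"
    proof (rule N.finsum_cong')
      fix j assume j: "j \<in> S"
      then have "h j (c \<odot>\<^bsub>M\<^esub> x) = c \<odot>\<^bsub>N\<^esub> h j x"
        using module_hom_smult[OF hom] c x by blast
      then show "s j \<odot>\<^bsub>N\<^esub> h j (c \<odot>\<^bsub>M\<^esub> x) = c \<odot>\<^bsub>N\<^esub> (s j \<odot>\<^bsub>N\<^esub> h j x)"
        using hc[OF j x] sc[OF j] c by (simp add: R.m_comm flip: N.smult_assoc1)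
    qed (use hc sc c x in auto)
    also have "\<dots> = c \<odot>\<^bsub>N\<^esub> (\<Oplus>\<^bsub>N\<^esub> j \<in> S. s j \<odot>\<^bsub>N\<^esub> h j x)"
      using hc sc c x by (intro N.finsum_smult_ldistr[symmetric] assms(2)) auto
    finally show ?thesis .
  qed
  have closed: "(\<Oplus>\<^bsub>N\<^esub> j \<in> S. s j \<odot>\<^bsub>N\<^esub> h j x) \<in> carrier N" if "x \<in> carrier M" for x
    using hc sc that by (intro N.finsum_closed) auto
  show ?thesis by (auto simp: Hom_def module_hom_def closed add smult)
qed

text \<open>Inserting one multilinear map into the \<open>j\<close>-th entry of another, the operation on which the
  pre-Lie product is built.\<close>

lemma (in module) multilinear_insert:
  assumes V: "multilinear R M p N V" and W: "multilinear R M q M W" and j: "j < p"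
  shows "multilinear R M (p + q - 1) N
    (\<lambda>as. V (take j as @ [W (take q (drop j as))] @ drop (j + q) as))"
    (is "multilinear R M ?n N ?U")
proof -
  have W_in: "W (take q (drop j as)) \<in> carrier M" if "as \<in> tuples (carrier M) ?n" for as
    by (rule multilinear_closed[OF W])
       (use that j in \<open>auto simp: tuples_iff dest!: in_set_takeD in_set_dropD\<close>)
  have "?U \<in> tuples (carrier M) ?n \<rightarrow> carrier N"
  proof
    fix as assume as: "as \<in> tuples (carrier M) ?n"
    show "?U as \<in> carrier N"
      by (rule multilinear_closed[OF V])
         (use as j W_in[OF as] in \<open>auto simp: tuples_iff dest!: in_set_takeD in_set_dropD\<close>)
  qed
  moreover have "(\<lambda>a. ?U (xs @ a # ys)) \<in> module_hom R M N"
    if xs: "set xs \<subseteq> carrier M" and ys: "set ys \<subseteq> carrier M" and n: "length xs + length ys + 1 = ?n"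
    for xs ys
  proof -
    consider "length xs < j" | "j \<le> length xs" "length xs < j + q" | "j + q \<le> length xs" by linarith
    then show ?thesis
    proof cases
      case 1
      define m where "m = j - length xs - 1"
      have jm: "j = length xs + Suc m" using 1 by (simp add: m_def)
      have "W (take q (drop m ys)) \<in> carrier M"
        by (rule multilinear_closed[OF W])
           (use ys n j jm in \<open>auto simp: tuples_iff dest!: in_set_takeD in_set_dropD\<close>)
      then have "(\<lambda>a. V (xs @ a # (take m ys @ [W (take q (drop m ys))] @ drop (m + q) ys)))
          \<in> module_hom R M N"
        by (intro multilinear_slot[OF V])
           (use xs ys n j jm in \<open>auto dest!: in_set_takeD in_set_dropD\<close>)
      then show ?thesis by (simp add: jm)
    next
      case 2
      define m where "m = j + q - length xs - 1"
      have jm: "j + q = length xs + Suc m" and qm: "q = length xs - j + Suc m"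
        using 2 by (simp_all add: m_def)
      have "(\<lambda>a. W (drop j xs @ a # take m ys)) \<in> module_hom R M M"
        by (rule multilinear_slot[OF W])
           (use xs ys n j qm 2 in \<open>auto dest!: in_set_takeD in_set_dropD\<close>)
      moreover have "(\<lambda>a. V (take j xs @ a # drop m ys)) \<in> module_hom R M N"
        by (rule multilinear_slot[OF V])
           (use xs ys n j jm 2 in \<open>auto dest!: in_set_takeD in_set_dropD\<close>)
      ultimately have "(\<lambda>a. V (take j xs @ W (drop j xs @ a # take m ys) # drop m ys)) \<in> module_hom R M N"
        by (rule module_hom_compose)
      moreover have "?U (xs @ a # ys) = V (take j xs @ W (drop j xs @ a # take m ys) # drop m ys)" for a
        using 2 by (simp add: jm) (simp add: qm)
      ultimately show ?thesis by simp
    next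
      case 3
      have "W (take q (drop j xs)) \<in> carrier M"
        by (rule multilinear_closed[OF W])
           (use xs 3 in \<open>auto simp: tuples_iff dest!: in_set_takeD in_set_dropD\<close>)
      then have "(\<lambda>a. V ((take j xs @ [W (take q (drop j xs))] @ drop (j + q) xs) @ a # ys))
          \<in> module_hom R M N"
        by (intro multilinear_slot[OF V])
           (use xs ys n j 3 in \<open>auto dest!: in_set_takeD in_set_dropD\<close>)
      then show ?thesis using 3 by simp
    qed
  qed
  ultimately show ?thesis unfolding multilinear_def by blast
qed

section \<open>Products of basis elements\<close>

lemma (in monoid) list_mult_closed: "set xs \<subseteq> carrier G \<Longrightarrow> list_mult G xs \<in> carrier G"
  by (induction xs) auto

lemma (in monoid) list_mult_append:
  "set xs \<subseteq> carrier G \<Longrightarrow> set ys \<subseteq> carrier G \<Longrightarrow>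
     list_mult G (xs @ ys) = list_mult G xs \<otimes> list_mult G ys"
  by (induction xs) (simp_all add: list_mult_closed m_assoc)

text \<open>The setting of the theorem, with the basis given as a set.\<close>

locale idempotent_basis_algebra = unital_algebra k A for k and A (structure) +
  fixes B
  assumes basis: "module_basis k A B"
    and mult_basis: "\<lbrakk>a \<in> B; b \<in> B\<rbrakk> \<Longrightarrow> \<exists>m\<in>B. \<exists>\<mu>\<in>carrier k.
      \<mu> \<otimes>\<^bsub>k\<^esub> \<mu> = \<mu> \<and> a \<otimes>\<^bsub>A\<^esub> b = \<mu> \<odot>\<^bsub>A\<^esub> m"
begin

lemmas module_A = module_axioms

lemma B_closed: "B \<subseteq> carrier A"
  by (rule basis_closed[OF basis])

lemma tuples_B_closed: "xs \<in> tuples B n \<Longrightarrow> xs \<in> tuples (carrier A) n"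
  using B_closed by (auto simp: tuples_iff)

lemma module_self: "module k (self_module k)"
  by (rule module_self_module[OF R.is_cring])

lemma multilinear_list_mult: "multilinear k A n A (list_mult A)"
  unfolding multilinear_def
proof (intro conjI allI impI)
  show "list_mult A \<in> tuples (carrier A) n \<rightarrow> carrier A"
    by (auto simp: tuples_iff M.list_mult_closed)
  fix xs ys assume xy: "set xs \<subseteq> carrier A \<and> set ys \<subseteq> carrier A \<and> length xs + length ys + 1 = n"
  then have "list_mult A xs \<in> carrier A" "list_mult A ys \<in> carrier A"
    by (auto intro: M.list_mult_closed)
  moreover have "list_mult A (xs @ a # ys) = list_mult A xs \<otimes>\<^bsub>A\<^esub> (a \<otimes>\<^bsub>A\<^esub> list_mult A ys)"
    if "a \<in> carrier A" for a using xy that by (simp add: M.list_mult_append)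
  ultimately show "(\<lambda>a. list_mult A (xs @ a # ys)) \<in> module_hom k A A"
    unfolding module_hom_def
    by (auto simp: M.l_distr M.r_distr smult_mult_left smult_mult_right)
qed

text \<open>The multiples of basis elements by idempotents of \<open>k\<close>. Unlike the basis, this set is closed
  under multiplication.\<close>

definition idempotent_multiples :: "'c set" where
  "idempotent_multiples = {c \<odot>\<^bsub>A\<^esub> b | c b. c \<in> carrier k \<and> c \<otimes>\<^bsub>k\<^esub> c = c \<and> b \<in> B}"

lemma idempotent_multiples_closed: "idempotent_multiples \<subseteq> carrier A"
  using B_closed by (auto simp: idempotent_multiples_def)

lemma B_idempotent_multiples: "B \<subseteq> idempotent_multiples"
proof
  fix b assume b: "b \<in> B"
  then have "b = \<one>\<^bsub>k\<^esub> \<odot>\<^bsub>A\<^esub> b" using B_closed by auto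
  then show "b \<in> idempotent_multiples" using b unfolding idempotent_multiples_def by fastforce
qed

lemma idempotent_mult:
  assumes "c \<in> carrier k" "c \<otimes>\<^bsub>k\<^esub> c = c" "d \<in> carrier k" "d \<otimes>\<^bsub>k\<^esub> d = d"
  shows "(c \<otimes>\<^bsub>k\<^esub> d) \<otimes>\<^bsub>k\<^esub> (c \<otimes>\<^bsub>k\<^esub> d) = c \<otimes>\<^bsub>k\<^esub> d"
proof -
  have "(c \<otimes>\<^bsub>k\<^esub> d) \<otimes>\<^bsub>k\<^esub> (c \<otimes>\<^bsub>k\<^esub> d) = (c \<otimes>\<^bsub>k\<^esub> c) \<otimes>\<^bsub>k\<^esub> (d \<otimes>\<^bsub>k\<^esub> d)"
    using assms(1,3) by (simp add: R.m_ac)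
  then show ?thesis using assms by simp
qed

lemma idempotent_multiples_mult:
  assumes "x \<in> idempotent_multiples" "y \<in> idempotent_multiples"
  shows "x \<otimes>\<^bsub>A\<^esub> y \<in> idempotent_multiples"
proof -
  obtain c b d e where x: "x = c \<odot>\<^bsub>A\<^esub> b" "c \<in> carrier k" "c \<otimes>\<^bsub>k\<^esub> c = c" "b \<in> B"
    and y: "y = d \<odot>\<^bsub>A\<^esub> e" "d \<in> carrier k" "d \<otimes>\<^bsub>k\<^esub> d = d" "e \<in> B"
    using assms by (auto simp: idempotent_multiples_def)
  obtain m \<mu> where m: "m \<in> B" "\<mu> \<in> carrier k" "\<mu> \<otimes>\<^bsub>k\<^esub> \<mu> = \<mu>" "b \<otimes>\<^bsub>A\<^esub> e = \<mu> \<odot>\<^bsub>A\<^esub> m"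
    using mult_basis[OF x(4) y(4)] by blast
  have c: "b \<in> carrier A" "e \<in> carrier A" "m \<in> carrier A" using x(4) y(4) m(1) B_closed by auto
  have "x \<otimes>\<^bsub>A\<^esub> y = d \<odot>\<^bsub>A\<^esub> (c \<odot>\<^bsub>A\<^esub> (b \<otimes>\<^bsub>A\<^esub> e))"
    unfolding x(1) y(1) using x(2) y(2) c by (simp add: smult_mult_left smult_mult_right)
  also have "\<dots> = (d \<otimes>\<^bsub>k\<^esub> c \<otimes>\<^bsub>k\<^esub> \<mu>) \<odot>\<^bsub>A\<^esub> m"
    unfolding m(4) using x(2) y(2) m(2) c by (simp add: smult_assoc1)
  finally show ?thesis
    unfolding idempotent_multiples_def
    using idempotent_mult[OF _ idempotent_mult[OF y(2,3) x(2,3)] m(2,3)] x(2) y(2) m(1,2) by auto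
qed

lemma list_mult_idempotent_multiples:
  assumes "xs \<noteq> []" "set xs \<subseteq> idempotent_multiples"
  shows "list_mult A xs \<in> idempotent_multiples"
  using assms
proof (induction xs rule: list_nonempty_induct)
  case (single x)
  then have "x \<in> carrier A" using idempotent_multiples_closed by auto
  then show ?case using single by simp
qed (simp add: idempotent_multiples_mult)

lemma idempotent_multiples_tuple:
  assumes "set xs \<subseteq> idempotent_multiples"
  shows "\<exists>cs bs. xs = map2 (smult A) cs bs \<and> length cs = length bs \<and> set bs \<subseteq> B \<and>
    set cs \<subseteq> {c \<in> carrier k. c \<otimes>\<^bsub>k\<^esub> c = c}"
  using assms
proof (induction xs)
  case (Cons x xs)
  obtain c b where x: "x = c \<odot>\<^bsub>A\<^esub> b" "c \<in> carrier k" "c \<otimes>\<^bsub>k\<^esub> c = c" "b \<in> B"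
    using Cons.prems by (auto simp: idempotent_multiples_def)
  have "set xs \<subseteq> idempotent_multiples" using Cons.prems by simp
  from Cons.IH[OF this] obtain cs bs where "xs = map2 (smult A) cs bs" "length cs = length bs"
    "set bs \<subseteq> B" "set cs \<subseteq> {c \<in> carrier k. c \<otimes>\<^bsub>k\<^esub> c = c}"
    by (elim exE conjE)
  then show ?case using x by (intro exI[of _ "c # cs"] exI[of _ "b # bs"]) simp
qed (intro exI[of _ "[]"], simp)

lemma list_mult_idempotent:
  "set cs \<subseteq> {c \<in> carrier k. c \<otimes>\<^bsub>k\<^esub> c = c} \<Longrightarrow>
     list_mult k cs \<in> carrier k \<and> list_mult k cs \<otimes>\<^bsub>k\<^esub> list_mult k cs = list_mult k cs"
  by (induction cs) (auto simp: idempotent_mult)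

section \<open>The map from scalar cochains to autopoietic cochains\<close>

lemma scalar_cochain_pure_closed:
  assumes "\<alpha> \<in> Hom k (tensor_power k A n) (self_module k)" "xs \<in> tuples (carrier A) n"
  shows "\<alpha> (pure k A xs) \<in> carrier k"
  using module_hom_closed[of \<alpha> k "tensor_power k A n" "self_module k"] assms pure_closed[OF assms(2)]
  by (auto simp: Hom_def self_module_def)

lemma
  assumes "\<alpha> \<in> Hom k (tensor_power k A n) (self_module k)"
  shows Psi_Hom: "Psi k A B n \<alpha> \<in> Hom k (tensor_power k A n) A"
    and Psi_basis: "xs \<in> tuples B n \<Longrightarrow> Psi k A B n \<alpha> (pure k A xs) = \<alpha> (pure k A xs) \<odot>\<^bsub>A\<^esub> list_mult A xs"
proof -
  have v: "(\<lambda>xs. \<alpha> (pure k A xs) \<odot>\<^bsub>A\<^esub> list_mult A xs) \<in> tuples B n \<rightarrow> carrier A"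
    using scalar_cochain_pure_closed[OF assms] tuples_B_closed multilinear_closed[OF multilinear_list_mult]
    by blast
  show "Psi k A B n \<alpha> \<in> Hom k (tensor_power k A n) A"
    unfolding Psi_def by (rule tensor_map_basis_Hom[OF basis module_A v])
  show "Psi k A B n \<alpha> (pure k A xs) = \<alpha> (pure k A xs) \<odot>\<^bsub>A\<^esub> list_mult A xs" if "xs \<in> tuples B n"
    unfolding Psi_def using tensor_map_basis_pure[OF basis module_A v that] .
qed

text \<open>The formula defining \<^const>\<open>Psi\<close> on basis tuples persists for idempotent multiples of basis
  elements. Its left side is linear in the scalar \<open>c\<close> split off from the tuple, its right side is
  quadratic, and \<open>c\<close> is idempotent. This is where the hypothesis on the basis enters for the inner
  block of the pre-Lie product.\<close>

lemma Psi_idempotent_multiples: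
  assumes \<alpha>: "\<alpha> \<in> Hom k (tensor_power k A n) (self_module k)"
    and xs: "set xs \<subseteq> idempotent_multiples" "length xs = n"
  shows "Psi k A B n \<alpha> (pure k A xs) = \<alpha> (pure k A xs) \<odot>\<^bsub>A\<^esub> list_mult A xs"
proof -
  obtain cs bs where cb: "xs = map2 (smult A) cs bs" "length cs = length bs" "set bs \<subseteq> B"
    "set cs \<subseteq> {c \<in> carrier k. c \<otimes>\<^bsub>k\<^esub> c = c}"
    using idempotent_multiples_tuple[OF xs(1)] by (elim exE conjE)
  let ?c = "list_mult k cs"
  have c: "?c \<in> carrier k" "?c \<otimes>\<^bsub>k\<^esub> ?c = ?c" using list_mult_idempotent[OF cb(4)] by auto
  have lbs: "length bs = n" using cb(1,2) xs(2) by simp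
  have bs: "bs \<in> tuples B n" using cb(3) lbs by (simp add: tuples_iff)
  have carr: "set cs \<subseteq> carrier k" "set bs \<subseteq> carrier A" using cb(3,4) B_closed by auto
  have scale: "V xs = ?c \<odot>\<^bsub>A\<^esub> V bs" if "multilinear k A n A V" for V
    using multilinear_map2_smult[OF that module_A, of cs bs "[]"] cb(1,2) carr lbs by simp
  have scale_self: "W xs = ?c \<odot>\<^bsub>self_module k\<^esub> W bs" if "multilinear k A n (self_module k) W" for W
    using multilinear_map2_smult[OF that module_self, of cs bs "[]"] cb(1,2) carr lbs by simp
  have a: "\<alpha> (pure k A xs) = ?c \<otimes>\<^bsub>k\<^esub> \<alpha> (pure k A bs)"
    using scale_self[OF multilinear_Hom_pure[OF \<alpha>]] by (simp add: self_module_def)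
  have ac: "\<alpha> (pure k A bs) \<in> carrier k" using scalar_cochain_pure_closed[OF \<alpha> tuples_B_closed[OF bs]] .
  have lc: "list_mult A bs \<in> carrier A"
    using multilinear_closed[OF multilinear_list_mult tuples_B_closed[OF bs]] .
  have "Psi k A B n \<alpha> (pure k A xs) = ?c \<odot>\<^bsub>A\<^esub> (\<alpha> (pure k A bs) \<odot>\<^bsub>A\<^esub> list_mult A bs)"
    using scale[OF multilinear_Hom_pure[OF Psi_Hom[OF \<alpha>]]] Psi_basis[OF \<alpha> bs] by simp
  also have "\<dots> = ((?c \<otimes>\<^bsub>k\<^esub> ?c) \<otimes>\<^bsub>k\<^esub> \<alpha> (pure k A bs)) \<odot>\<^bsub>A\<^esub> list_mult A bs"
    using c ac lc by (simp add: smult_assoc1)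
  also have "(?c \<otimes>\<^bsub>k\<^esub> ?c) \<otimes>\<^bsub>k\<^esub> \<alpha> (pure k A bs) = \<alpha> (pure k A xs) \<otimes>\<^bsub>k\<^esub> ?c"
    unfolding a using c(1) ac by (simp add: R.m_ac)
  also have "(\<alpha> (pure k A xs) \<otimes>\<^bsub>k\<^esub> ?c) \<odot>\<^bsub>A\<^esub> list_mult A bs = \<alpha> (pure k A xs) \<odot>\<^bsub>A\<^esub> list_mult A xs"
    using scale[OF multilinear_list_mult] a c(1) ac lc by (simp add: smult_assoc1)
  finally show ?thesis .
qed

lemma Psi_AP:
  assumes "\<alpha> \<in> Hom k (tensor_power k A n) (self_module k)"
  shows "Psi k A B n \<alpha> \<in> AP k A B n"
  unfolding AP_def
  using Psi_Hom[OF assms] Psi_basis[OF assms] scalar_cochain_pure_closed[OF assms tuples_B_closed] by blast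

section \<open>Iterated faces\<close>

lemma
  assumes n: "2 \<le> n" "i \<le> n"
  shows face_Hom: "face k A B n i \<in> Hom k (tensor_power k A n) (tensor_power k A (n - 1))"
    and face_basis: "xs \<in> tuples B n \<Longrightarrow> face k A B n i (pure k A xs) = pure k A
       (if i = 0 then tl xs
        else if i < n then take (i - 1) xs @ [xs ! (i - 1) \<otimes>\<^bsub>A\<^esub> xs ! i] @ drop (i + 1) xs
        else butlast xs)"
proof -
  let ?f = "\<lambda>xs. if i = 0 then tl xs
        else if i < n then take (i - 1) xs @ [xs ! (i - 1) \<otimes>\<^bsub>A\<^esub> xs ! i] @ drop (i + 1) xs
        else butlast xs"
  have "?f xs \<in> tuples (carrier A) (n - 1)" if "xs \<in> tuples B n" for xs
  proof -
    have xs: "set xs \<subseteq> carrier A" "length xs = n" using tuples_B_closed[OF that] by (auto simp: tuples_iff)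
    have "xs ! m \<in> carrier A" if "m < n" for m using xs that nth_mem[of m xs] by blast
    then show ?thesis using xs n
      by (auto simp: tuples_iff dest!: in_set_takeD in_set_dropD in_set_butlastD list.set_sel(2)[rotated])
  qed
  then have v: "(\<lambda>xs. pure k A (?f xs)) \<in> tuples B n \<rightarrow> carrier (tensor_power k A (n - 1))"
    using pure_closed by blast
  show "face k A B n i \<in> Hom k (tensor_power k A n) (tensor_power k A (n - 1))"
    unfolding face_def by (rule tensor_map_basis_Hom[OF basis module_tensor_power v])
  show "face k A B n i (pure k A xs) = pure k A (?f xs)" if "xs \<in> tuples B n"
    unfolding face_def using tensor_map_basis_pure[OF basis module_tensor_power v that] .
qed

text \<open>An inner face keeps its formula on idempotent multiples of basis elements, since multiplying two
  adjacent entries is multilinear. The outer faces do not: they delete an entry but not the scalar in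
  front of it.\<close>

lemma face_inner:
  assumes us: "set us \<subseteq> idempotent_multiples" and vs: "set vs \<subseteq> idempotent_multiples"
    and x: "x \<in> idempotent_multiples" and y: "y \<in> idempotent_multiples"
    and n: "n = length us + 2 + length vs"
  shows "face k A B n (length us + 1) (pure k A (us @ x # y # vs)) = pure k A (us @ (x \<otimes>\<^bsub>A\<^esub> y) # vs)"
proof -
  obtain cs us' where us': "us = map2 (smult A) cs us'" "length cs = length us'" "set us' \<subseteq> B"
    "set cs \<subseteq> {c \<in> carrier k. c \<otimes>\<^bsub>k\<^esub> c = c}"
    using idempotent_multiples_tuple[OF us] by (elim exE conjE)
  obtain ds vs' where vs': "vs = map2 (smult A) ds vs'" "length ds = length vs'" "set vs' \<subseteq> B"
    "set ds \<subseteq> {c \<in> carrier k. c \<otimes>\<^bsub>k\<^esub> c = c}"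
    using idempotent_multiples_tuple[OF vs] by (elim exE conjE)
  obtain c x' where x': "x = c \<odot>\<^bsub>A\<^esub> x'" "c \<in> carrier k" "x' \<in> B"
    using x by (auto simp: idempotent_multiples_def)
  obtain d y' where y': "y = d \<odot>\<^bsub>A\<^esub> y'" "d \<in> carrier k" "y' \<in> B"
    using y by (auto simp: idempotent_multiples_def)
  have carr: "set us' \<subseteq> carrier A" "set vs' \<subseteq> carrier A" "x' \<in> carrier A" "y' \<in> carrier A"
    using us'(3) vs'(3) x'(3) y'(3) B_closed by auto
  have sc: "set cs \<subseteq> carrier k" "set ds \<subseteq> carrier k" using us'(4) vs'(4) by auto
  have len: "length us = length us'" "n = length us' + 2 + length vs'"
    using n us'(1,2) vs'(1,2) by simp_all
  let ?f = "face k A B n (length us' + 1)"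
  have f: "?f \<in> Hom k (tensor_power k A n) (tensor_power k A (n - 1))"
    by (rule face_Hom) (use len in auto)
  have "us @ x # y # vs = map2 (smult A) (cs @ c # d # ds) (us' @ x' # y' # vs')"
    using us'(1,2) vs'(1,2) x'(1) y'(1) by simp
  then have "?f (pure k A (us @ x # y # vs)) = list_mult k (cs @ c # d # ds)
      \<odot>\<^bsub>tensor_power k A (n - 1)\<^esub> ?f (pure k A (us' @ x' # y' # vs'))"
    using multilinear_map2_smult[OF multilinear_Hom_pure[OF f] module_tensor_power,
        of "cs @ c # d # ds" "us' @ x' # y' # vs'" "[]"]
      us'(2) vs'(2) sc carr x'(2) y'(2) len(2) by simp
  also have "?f (pure k A (us' @ x' # y' # vs')) = pure k A (us' @ (x' \<otimes>\<^bsub>A\<^esub> y') # vs')"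
    using face_basis[of n "length us' + 1" "us' @ x' # y' # vs'"] len(2) us'(3) vs'(3) x'(3) y'(3)
    by (simp add: tuples_iff nth_append)
  also have "list_mult k (cs @ c # d # ds) = list_mult k (cs @ (c \<otimes>\<^bsub>k\<^esub> d) # ds)"
    using sc x'(2) y'(2) by (simp add: R.list_mult_append R.list_mult_closed R.m_assoc)
  also have "list_mult k (cs @ (c \<otimes>\<^bsub>k\<^esub> d) # ds)
      \<odot>\<^bsub>tensor_power k A (n - 1)\<^esub> pure k A (us' @ (x' \<otimes>\<^bsub>A\<^esub> y') # vs')
      = pure k A (map2 (smult A) (cs @ (c \<otimes>\<^bsub>k\<^esub> d) # ds) (us' @ (x' \<otimes>\<^bsub>A\<^esub> y') # vs'))"
    using multilinear_map2_smult[OF multilinear_pure module_tensor_power,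
        of "cs @ (c \<otimes>\<^bsub>k\<^esub> d) # ds" "us' @ (x' \<otimes>\<^bsub>A\<^esub> y') # vs'" "[]" "n - 1"]
      us'(2) vs'(2) sc carr x'(2) y'(2) len(2) by simp
  also have "map2 (smult A) (cs @ (c \<otimes>\<^bsub>k\<^esub> d) # ds) (us' @ (x' \<otimes>\<^bsub>A\<^esub> y') # vs')
      = us @ (x \<otimes>\<^bsub>A\<^esub> y) # vs"
    using us'(1,2) vs'(1,2) x'(1,2) y'(1,2) carr R.m_comm[of c d]
    by (simp add: smult_assoc1 smult_mult_left smult_mult_right)
  finally show ?thesis unfolding len(1) .
qed

text \<open>Consecutive inner faces multiply out a block \<open>ms\<close> of entries.\<close>

lemma faces_inner:
  assumes "ms \<noteq> []" "set us \<subseteq> idempotent_multiples" "set ms \<subseteq> idempotent_multiples"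
    and vs: "set vs \<subseteq> idempotent_multiples" and "n = length us + length ms + length vs"
  shows "faces k A B n [length us + 1..<length us + length ms] (pure k A (us @ ms @ vs)) =
    pure k A (us @ list_mult A ms # vs)"
  using assms(1-3,5)
proof (induction ms arbitrary: us rule: list_nonempty_induct)
  case (single x)
  then have "x \<in> carrier A" using idempotent_multiples_closed by auto
  then show ?case by simp
next
  case (cons x ms)
  let ?is = "[length (us @ [x]) + 1..<length (us @ [x]) + length ms]"
  have "[length us + 1..<length us + length (x # ms)] = (length us + 1) # ?is"
    using cons.hyps by (simp add: upt_conv_Cons del: upt_Suc)
  moreover have "faces k A B n ?is (pure k A ((us @ [x]) @ ms @ vs)) =
      pure k A ((us @ [x]) @ list_mult A ms # vs)"
    using cons.prems by (intro cons.IH) auto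
  moreover have "n - length ?is = length us + 2 + length vs"
  proof -
    have "1 \<le> length ms" using cons.hyps by (cases ms) auto
    then show ?thesis using cons.prems by simp
  qed
  moreover have "face k A B (length us + 2 + length vs) (length us + 1)
      (pure k A (us @ x # list_mult A ms # vs)) = pure k A (us @ (x \<otimes>\<^bsub>A\<^esub> list_mult A ms) # vs)"
    using cons.prems cons.hyps vs by (intro face_inner list_mult_idempotent_multiples) auto
  ultimately show ?case by simp
qed

lemma faces_append:
  "faces k A B n (is @ js) \<sigma> = faces k A B (n - length js) is (faces k A B n js \<sigma>)"
  by (induction "is") (simp_all add: add.commute)

text \<open>Each of these faces acts in the degree of its own index, so it deletes the last entry.\<close>

lemma faces_last:
  assumes xs: "xs \<in> tuples B n" and "m \<le> n" "1 \<le> m"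
  shows "faces k A B n [m + 1..<n + 1] (pure k A xs) = pure k A (take m xs)"
  using assms(2,3)
proof (induction m rule: inc_induct)
  case base
  then show ?case using xs by (simp add: tuples_iff)
next
  case (step m)
  have "[m + 1..<n + 1] = (m + 1) # [Suc m + 1..<n + 1]" using step.hyps by (simp add: upt_conv_Cons)
  moreover have "n - length [Suc m + 1..<n + 1] = m + 1" using step.hyps by simp
  moreover have "take (Suc m) xs \<in> tuples B (m + 1)"
    using xs step.hyps by (auto simp: tuples_iff dest: in_set_takeD)
  then have "face k A B (m + 1) (m + 1) (pure k A (take (Suc m) xs)) = pure k A (take m xs)"
    using face_basis[of "m + 1" "m + 1" "take (Suc m) xs"] step xs
    by (simp add: butlast_take tuples_iff)
  ultimately show ?case using step by simp
qed

text \<open>The composite \<open>d\<^sub>0 d\<^sub>1 \<dots> d\<^bsub>j-1\<^esub>\<close> does not simply delete the first \<open>j\<close> entries: the faces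
  \<open>d\<^sub>1, \<dots>, d\<^bsub>j-1\<^esub>\<close> come first and multiply these entries, and \<open>d\<^sub>0\<close> deletes the basis element in their
  product \<open>\<mu> b\<close>, leaving the scalar \<open>\<mu>\<close>. As \<open>\<mu>\<close> is idempotent, it is absorbed by that product.\<close>

lemma faces_first:
  assumes xs: "xs \<in> tuples B n" and "q = n - j" "j < n"
  obtains \<mu> where "\<mu> \<in> carrier k"
    "faces k A B n [0..<j] (pure k A xs) = \<mu> \<odot>\<^bsub>tensor_power k A q\<^esub> pure k A (drop j xs)"
    "\<mu> \<odot>\<^bsub>A\<^esub> list_mult A (take j xs) = list_mult A (take j xs)"
proof (cases "j = 0")
  case True
  have "pure k A xs \<in> carrier (tensor_power k A q)"
    using pure_closed[OF tuples_B_closed[OF xs]] assms(2) True by simp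
  then show ?thesis using that[of "\<one>\<^bsub>k\<^esub>"] True module.smult_one[OF module_tensor_power[of q]] by simp
next
  case False
  let ?ms = "take j xs" and ?vs = "drop j xs"
  have len: "length ?ms = j" "length ?vs = q" "?ms \<noteq> []" "n = j + q" "1 \<le> q"
    using xs assms(2,3) False by (auto simp: tuples_iff)
  have B: "set ?ms \<subseteq> B" "set ?vs \<subseteq> B"
    using xs by (auto simp: tuples_iff dest: in_set_takeD in_set_dropD)
  have I: "set ?ms \<subseteq> idempotent_multiples" "set ?vs \<subseteq> idempotent_multiples"
    using B B_idempotent_multiples by auto
  obtain \<mu> b where \<mu>: "\<mu> \<in> carrier k" "\<mu> \<otimes>\<^bsub>k\<^esub> \<mu> = \<mu>" "b \<in> B" "list_mult A ?ms = \<mu> \<odot>\<^bsub>A\<^esub> b"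
    using list_mult_idempotent_multiples[OF len(3) I(1)] by (auto simp: idempotent_multiples_def)
  have b: "b \<in> carrier A" using \<mu>(3) B_closed by auto
  have f: "face k A B (q + 1) 0 \<in> Hom k (tensor_power k A (q + 1)) (tensor_power k A q)"
    using face_Hom[of "q + 1" 0] len(5) by simp
  have "[0..<j] = 0 # [1..<j]" using False by (simp add: upt_conv_Cons)
  moreover have "n - length [1..<j] = q + 1" using len False by simp
  moreover have "faces k A B n [1..<j] (pure k A xs) = pure k A (list_mult A ?ms # ?vs)"
  proof -
    have "faces k A B n [length ([] :: 'c list) + 1..<length ([] :: 'c list) + length ?ms] (pure k A ([] @ ?ms @ ?vs)) =
        pure k A ([] @ list_mult A ?ms # ?vs)"
      by (rule faces_inner[OF len(3) _ I]) (use len(1,2,4) in simp_all)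
    then show ?thesis unfolding len(1) by simp
  qed
  ultimately have "faces k A B n [0..<j] (pure k A xs) =
      face k A B (q + 1) 0 (pure k A ((\<mu> \<odot>\<^bsub>A\<^esub> b) # ?vs))"
    using \<mu>(4) by simp
  also have "\<dots> = \<mu> \<odot>\<^bsub>tensor_power k A q\<^esub> face k A B (q + 1) 0 (pure k A (b # ?vs))"
    using multilinear_smult[OF multilinear_Hom_pure[OF f], of "[]" ?vs \<mu> b] B(2) B_closed len(2) \<mu>(1) b
    by auto
  also have "face k A B (q + 1) 0 (pure k A (b # ?vs)) = pure k A ?vs"
    using face_basis[of "q + 1" 0 "b # ?vs"] len \<mu>(3) B(2) by (simp add: tuples_iff)
  finally have eq: "faces k A B n [0..<j] (pure k A xs) = \<mu> \<odot>\<^bsub>tensor_power k A q\<^esub> pure k A ?vs" .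
  have "\<mu> \<odot>\<^bsub>A\<^esub> (\<mu> \<odot>\<^bsub>A\<^esub> b) = \<mu> \<odot>\<^bsub>A\<^esub> b" using \<mu>(1,2) b by (simp flip: smult_assoc1)
  then show ?thesis using that[OF \<mu>(1) eq] \<mu>(4) by simp
qed

section \<open>The cup-one product and the pre-Lie product\<close>

lemma pre_lie_at_value:
  assumes f: "f \<in> Hom k (tensor_power k A p) A" and g: "g \<in> Hom k (tensor_power k A q) A" and j: "j < p"
  shows pre_lie_at_Hom: "pre_lie_at k A p q j f g \<in> Hom k (tensor_power k A (p + q - 1)) A"
    and pre_lie_at_pure: "as \<in> tuples (carrier A) (p + q - 1) \<Longrightarrow>
      pre_lie_at k A p q j f g (pure k A as) =
      f (pure k A (take j as @ [g (pure k A (take q (drop j as)))] @ drop (j + q) as))"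
proof -
  note V = multilinear_insert[OF multilinear_Hom_pure[OF f] multilinear_Hom_pure[OF g] j]
  show "pre_lie_at k A p q j f g \<in> Hom k (tensor_power k A (p + q - 1)) A"
    unfolding pre_lie_at_def by (rule tensor_map_multilinear_Hom[OF module_A V])
  show "pre_lie_at k A p q j f g (pure k A as) =
      f (pure k A (take j as @ [g (pure k A (take q (drop j as)))] @ drop (j + q) as))"
    if "as \<in> tuples (carrier A) (p + q - 1)"
    unfolding pre_lie_at_def using tensor_map_multilinear_pure[OF module_A V that] .
qed

lemma sign_closed: "sign k e \<in> carrier k"
  by (simp add: sign_def)

lemma pre_lie_Hom:
  assumes "f \<in> Hom k (tensor_power k A p) A" "g \<in> Hom k (tensor_power k A q) A"
  shows "pre_lie k A p q f g \<in> Hom k (tensor_power k A (p + q - 1)) A"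
  unfolding pre_lie_def
  by (rule module.Hom_linear_combination[OF module_tensor_power module_A])
     (use pre_lie_at_Hom[OF assms] sign_closed in auto)

context
  fixes p q \<alpha> \<beta>
  assumes p: "1 \<le> p" and q: "1 \<le> q"
    and \<alpha>: "\<alpha> \<in> Hom k (tensor_power k A p) (self_module k)"
    and \<beta>: "\<beta> \<in> Hom k (tensor_power k A q) (self_module k)"
begin

text \<open>The arguments of \<open>\<alpha>\<close> and \<open>\<beta>\<close> in the \<open>j\<close>-th summand of the cup-one product: the tuple \<open>ys\<close>
  arises from \<open>xs\<close> by multiplying out the block \<open>zs\<close> of the \<open>q\<close> entries after the \<open>j\<close>-th one; the
  argument of \<open>\<beta>\<close> is \<open>zs\<close> up to a scalar absorbed by the product of \<open>xs\<close>.\<close>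

lemma cup_one_factors:
  assumes xs: "xs \<in> tuples B (p + q - 1)" and j: "j < p"
  defines "ys \<equiv> take j xs @ list_mult A (take q (drop j xs)) # drop (j + q) xs"
    and "zs \<equiv> take q (drop j xs)"
  obtains \<mu> where "\<mu> \<in> carrier k"
    "faces k A B (p + q - 1) [j + 1..<j + q] (pure k A xs) = pure k A ys"
    "\<beta> (faces k A B (p + q - 1) ([0..<j] @ [j + q + 1..<p + q]) (pure k A xs)) = \<mu> \<otimes>\<^bsub>k\<^esub> \<beta> (pure k A zs)"
    "\<mu> \<odot>\<^bsub>A\<^esub> list_mult A xs = list_mult A xs"
    "set ys \<subseteq> idempotent_multiples" "length ys = p" "set zs \<subseteq> B" "length zs = q"
    "list_mult A ys = list_mult A xs"
proof -
  let ?n = "p + q - 1" and ?us = "take j xs" and ?vs = "drop (j + q) xs"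
  have n: "j + q \<le> ?n" "?n + 1 = p + q" using p q j by auto
  have lx: "length xs = ?n" "set xs \<subseteq> B" using xs by (auto simp: tuples_iff)
  have split: "xs = ?us @ zs @ ?vs"
    unfolding zs_def by (metis append_take_drop_id drop_drop add.commute)
  have len: "length ?us = j" "length zs = q" "?n = j + q + length ?vs" "zs \<noteq> []"
    using lx(1) n q by (auto simp: zs_def)
  have sets: "set ?us \<subseteq> B" "set zs \<subseteq> B" "set ?vs \<subseteq> B"
    using lx(2) by (auto simp: zs_def dest!: in_set_takeD in_set_dropD)
  note setsI = sets[THEN subset_trans, OF B_idempotent_multiples]
  note setsA = sets[THEN subset_trans, OF B_closed]
  have A: "faces k A B ?n [j + 1..<j + q] (pure k A xs) = pure k A ys"
    using faces_inner[OF len(4) setsI(1,2,3), of ?n] len split by (simp add: ys_def zs_def)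
  have ys: "set ys \<subseteq> idempotent_multiples" "length ys = p"
    using setsI list_mult_idempotent_multiples[OF len(4) setsI(2)] len n lx(1) j
    by (auto simp: ys_def zs_def)
  have lm: "list_mult A ys = list_mult A xs"
  proof -
    have "list_mult A xs = list_mult A ?us \<otimes>\<^bsub>A\<^esub> (list_mult A zs \<otimes>\<^bsub>A\<^esub> list_mult A ?vs)"
      by (subst split) (use setsA in \<open>simp add: M.list_mult_append\<close>)
    also have "\<dots> = list_mult A ys"
      unfolding ys_def zs_def[symmetric] using setsA
      by (simp add: M.list_mult_append M.list_mult_closed)
    finally show ?thesis by simp
  qed
  have "faces k A B ?n [j + q + 1..<p + q] (pure k A xs) = pure k A (take (j + q) xs)"
    using faces_last[OF xs n(1)] q n(2) by simp
  moreover have "?n - length [j + q + 1..<p + q] = j + q" using n by auto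
  ultimately have last: "faces k A B ?n ([0..<j] @ [j + q + 1..<p + q]) (pure k A xs) =
      faces k A B (j + q) [0..<j] (pure k A (take (j + q) xs))"
    by (simp only: faces_append)
  have "take (j + q) xs \<in> tuples B (j + q)"
    using lx n by (auto simp: tuples_iff dest: in_set_takeD)
  then obtain \<mu> where \<mu>: "\<mu> \<in> carrier k"
    "faces k A B (j + q) [0..<j] (pure k A (take (j + q) xs)) =
      \<mu> \<odot>\<^bsub>tensor_power k A q\<^esub> pure k A (drop j (take (j + q) xs))"
    "\<mu> \<odot>\<^bsub>A\<^esub> list_mult A (take j (take (j + q) xs)) = list_mult A (take j (take (j + q) xs))"
    by (rule faces_first[of _ _ q j]) (use q in auto)
  have zs_pure: "pure k A zs \<in> carrier (tensor_power k A q)"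
    using setsA(2) len(2) by (intro pure_closed) (simp add: tuples_iff)
  have "drop j (take (j + q) xs) = zs" by (simp add: zs_def drop_take)
  then have "\<beta> (faces k A B ?n ([0..<j] @ [j + q + 1..<p + q]) (pure k A xs)) =
      \<beta> (\<mu> \<odot>\<^bsub>tensor_power k A q\<^esub> pure k A zs)"
    using last \<mu>(2) by simp
  also have "\<dots> = \<mu> \<otimes>\<^bsub>k\<^esub> \<beta> (pure k A zs)"
    using module_hom_smult[of \<beta> k "tensor_power k A q" "self_module k" \<mu> "pure k A zs"] \<beta> \<mu>(1) zs_pure
    by (simp add: Hom_def self_module_def)
  finally have B: "\<beta> (faces k A B ?n ([0..<j] @ [j + q + 1..<p + q]) (pure k A xs)) =
    \<mu> \<otimes>\<^bsub>k\<^esub> \<beta> (pure k A zs)" .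
  have "\<mu> \<odot>\<^bsub>A\<^esub> list_mult A xs = list_mult A xs"
  proof -
    have us: "\<mu> \<odot>\<^bsub>A\<^esub> list_mult A ?us = list_mult A ?us" using \<mu>(3) by simp
    have "list_mult A xs = list_mult A ?us \<otimes>\<^bsub>A\<^esub> list_mult A (zs @ ?vs)"
      by (subst split) (use setsA in \<open>simp add: M.list_mult_append\<close>)
    moreover have "list_mult A (zs @ ?vs) \<in> carrier A" "list_mult A ?us \<in> carrier A"
      using setsA by (auto intro!: M.list_mult_closed)
    ultimately show ?thesis using us \<mu>(1) smult_mult_left by metis
  qed
  then show ?thesis using that \<mu>(1) A B ys sets(2) len(2) lm by blast
qed

text \<open>The \<open>j\<close>-th summand of the cup-one product on the basis tuple \<open>xs\<close>.\<close>

definition cup_one_term :: "'c list \<Rightarrow> nat \<Rightarrow> 'a" where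
  "cup_one_term xs j = sign k ((p - 1 - j) * (q - 1)) \<otimes>\<^bsub>k\<^esub>
     (\<alpha> (faces k A B (p + q - 1) [j + 1..<j + q] (pure k A xs)) \<otimes>\<^bsub>k\<^esub>
      \<beta> (faces k A B (p + q - 1) ([0..<j] @ [j + q + 1..<p + q]) (pure k A xs)))"

text \<open>The two products agree summand by summand.\<close>

lemma cup_one_term:
  assumes xs: "xs \<in> tuples B (p + q - 1)" and j: "j < p"
  shows cup_one_term_closed: "cup_one_term xs j \<in> carrier k"
    and cup_one_term_smult: "cup_one_term xs j \<odot>\<^bsub>A\<^esub> list_mult A xs =
      sign k ((p - 1 - j) * (q - 1)) \<odot>\<^bsub>A\<^esub>
        pre_lie_at k A p q j (Psi k A B p \<alpha>) (Psi k A B q \<beta>) (pure k A xs)"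
proof -
  let ?zs = "take q (drop j xs)" and ?s = "sign k ((p - 1 - j) * (q - 1))"
  let ?ys = "take j xs @ list_mult A ?zs # drop (j + q) xs"
  obtain \<mu> where \<mu>: "\<mu> \<in> carrier k"
    "faces k A B (p + q - 1) [j + 1..<j + q] (pure k A xs) = pure k A ?ys"
    "\<beta> (faces k A B (p + q - 1) ([0..<j] @ [j + q + 1..<p + q]) (pure k A xs)) = \<mu> \<otimes>\<^bsub>k\<^esub> \<beta> (pure k A ?zs)"
    "\<mu> \<odot>\<^bsub>A\<^esub> list_mult A xs = list_mult A xs"
    and ys: "set ?ys \<subseteq> idempotent_multiples" "length ?ys = p"
    and zs: "set ?zs \<subseteq> B" "length ?zs = q" and lm: "list_mult A ?ys = list_mult A xs"
    using cup_one_factors[OF xs j] .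
  let ?a = "\<alpha> (pure k A ?ys)" and ?b = "\<beta> (pure k A ?zs)"
  have ysA: "?ys \<in> tuples (carrier A) p" using ys idempotent_multiples_closed by (simp only: tuples_iff) blast
  have zsB: "?zs \<in> tuples B q" using zs by (simp add: tuples_iff)
  have a: "?a \<in> carrier k" by (rule scalar_cochain_pure_closed[OF \<alpha> ysA])
  have b: "?b \<in> carrier k" by (rule scalar_cochain_pure_closed[OF \<beta> tuples_B_closed[OF zsB]])
  have l: "list_mult A xs \<in> carrier A"
    using multilinear_closed[OF multilinear_list_mult tuples_B_closed[OF xs]] .
  have expand: "cup_one_term xs j = ?s \<otimes>\<^bsub>k\<^esub> (?a \<otimes>\<^bsub>k\<^esub> (\<mu> \<otimes>\<^bsub>k\<^esub> ?b))"
    unfolding cup_one_term_def \<mu>(2,3) ..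
  show "cup_one_term xs j \<in> carrier k" unfolding expand using a b \<mu>(1) sign_closed by simp
  have "pre_lie_at k A p q j (Psi k A B p \<alpha>) (Psi k A B q \<beta>) (pure k A xs) =
      Psi k A B p \<alpha> (pure k A (take j xs @ (?b \<odot>\<^bsub>A\<^esub> list_mult A ?zs) # drop (j + q) xs))"
    using pre_lie_at_pure[OF Psi_Hom[OF \<alpha>] Psi_Hom[OF \<beta>] j tuples_B_closed[OF xs]] Psi_basis[OF \<beta> zsB]
    by simp
  also have "\<dots> = ?b \<odot>\<^bsub>A\<^esub> Psi k A B p \<alpha> (pure k A ?ys)"
    by (rule multilinear_smult[OF multilinear_Hom_pure[OF Psi_Hom[OF \<alpha>]]])
       (use ysA b in \<open>auto simp: tuples_iff\<close>)
  also have "Psi k A B p \<alpha> (pure k A ?ys) = ?a \<odot>\<^bsub>A\<^esub> list_mult A xs"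
    using Psi_idempotent_multiples[OF \<alpha> ys] lm by simp
  finally have pre: "pre_lie_at k A p q j (Psi k A B p \<alpha>) (Psi k A B q \<beta>) (pure k A xs) =
      ?b \<odot>\<^bsub>A\<^esub> (?a \<odot>\<^bsub>A\<^esub> list_mult A xs)" .
  have "?s \<otimes>\<^bsub>k\<^esub> (?a \<otimes>\<^bsub>k\<^esub> (\<mu> \<otimes>\<^bsub>k\<^esub> ?b)) = ?s \<otimes>\<^bsub>k\<^esub> (?b \<otimes>\<^bsub>k\<^esub> (?a \<otimes>\<^bsub>k\<^esub> \<mu>))"
    using a b \<mu>(1) by (simp add: R.m_ac)
  then have "cup_one_term xs j \<odot>\<^bsub>A\<^esub> list_mult A xs =
      ?s \<odot>\<^bsub>A\<^esub> (?b \<odot>\<^bsub>A\<^esub> (?a \<odot>\<^bsub>A\<^esub> (\<mu> \<odot>\<^bsub>A\<^esub> list_mult A xs)))"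
    unfolding expand using a b \<mu>(1) l sign_closed by (simp add: smult_assoc1)
  then show "cup_one_term xs j \<odot>\<^bsub>A\<^esub> list_mult A xs = ?s \<odot>\<^bsub>A\<^esub>
        pre_lie_at k A p q j (Psi k A B p \<alpha>) (Psi k A B q \<beta>) (pure k A xs)"
    unfolding pre \<mu>(4) .
qed

lemma Psi_cup_one:
  "Psi k A B (p + q - 1) (cup_one k A B p q \<alpha> \<beta>) =
     pre_lie k A p q (Psi k A B p \<alpha>) (Psi k A B q \<beta>)"
proof -
  let ?n = "p + q - 1"
  have v: "(\<lambda>xs. \<Oplus>\<^bsub>k\<^esub> j \<in> {..<p}. cup_one_term xs j) \<in> tuples B ?n \<rightarrow> carrier (self_module k)"
    using cup_one_term_closed by (auto simp: self_module_def intro!: R.finsum_closed)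
  have cup: "cup_one k A B p q \<alpha> \<beta> =
      tensor_map k A B ?n (self_module k) (\<lambda>xs. \<Oplus>\<^bsub>k\<^esub> j \<in> {..<p}. cup_one_term xs j)"
    unfolding cup_one_def cup_one_term_def ..
  have hom: "cup_one k A B p q \<alpha> \<beta> \<in> Hom k (tensor_power k A ?n) (self_module k)"
    unfolding cup by (rule tensor_map_basis_Hom[OF basis module_self v])
  show ?thesis
  proof (rule Hom_tensor_power_basis_eqI[OF basis module_A Psi_Hom[OF hom]
        pre_lie_Hom[OF Psi_Hom[OF \<alpha>] Psi_Hom[OF \<beta>]]])
    fix xs assume xs: "xs \<in> tuples B ?n"
    have l: "list_mult A xs \<in> carrier A"
      using multilinear_closed[OF multilinear_list_mult tuples_B_closed[OF xs]] .
    have pre_closed: "pre_lie_at k A p q j (Psi k A B p \<alpha>) (Psi k A B q \<beta>) (pure k A xs) \<in> carrier A"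
      if "j < p" for j
      using multilinear_closed[OF multilinear_Hom_pure[OF
          pre_lie_at_Hom[OF Psi_Hom[OF \<alpha>] Psi_Hom[OF \<beta>] that]] tuples_B_closed[OF xs]] .
    have "Psi k A B ?n (cup_one k A B p q \<alpha> \<beta>) (pure k A xs) =
        (\<Oplus>\<^bsub>k\<^esub> j \<in> {..<p}. cup_one_term xs j) \<odot>\<^bsub>A\<^esub> list_mult A xs"
      unfolding Psi_basis[OF hom xs] unfolding cup tensor_map_basis_pure[OF basis module_self v xs] ..
    also have "\<dots> = (\<Oplus>\<^bsub>A\<^esub> j \<in> {..<p}. cup_one_term xs j \<odot>\<^bsub>A\<^esub> list_mult A xs)"
      using cup_one_term_closed[OF xs] l by (intro finsum_smult_rdistr) auto
    also have "\<dots> = (\<Oplus>\<^bsub>A\<^esub> j \<in> {..<p}. sign k ((p - 1 - j) * (q - 1)) \<odot>\<^bsub>A\<^esub>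
        pre_lie_at k A p q j (Psi k A B p \<alpha>) (Psi k A B q \<beta>) (pure k A xs))"
      using cup_one_term_smult[OF xs] pre_closed sign_closed by (intro M.finsum_cong') auto
    also have "\<dots> = pre_lie k A p q (Psi k A B p \<alpha>) (Psi k A B q \<beta>) (pure k A xs)"
      using pure_closed[OF tuples_B_closed[OF xs]] by (simp add: pre_lie_def)
    finally show "Psi k A B ?n (cup_one k A B p q \<alpha> \<beta>) (pure k A xs) =
      pre_lie k A p q (Psi k A B p \<alpha>) (Psi k A B q \<beta>) (pure k A xs)" .
  qed
qed

end

end

theorem theorem3p7:
  fixes k :: "'k ring" and A :: "('k, 'a) module"
    and \<Omega> :: "'w set" and \<phi> :: "'w \<Rightarrow> 'a"
  assumes "cring k"
    and "unital_algebra k A"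
    and "module_basis k A (\<phi> ` \<Omega>)"
    and "\<forall>a\<in>\<Omega>. \<forall>b\<in>\<Omega>. \<exists>m\<in>\<Omega>. \<exists>\<mu>\<in>carrier k.
           \<mu> \<otimes>\<^bsub>k\<^esub> \<mu> = \<mu> \<and> \<phi> a \<otimes>\<^bsub>A\<^esub> \<phi> b = \<mu> \<odot>\<^bsub>A\<^esub> \<phi> m"
  shows "(\<forall>n\<ge>1. Psi k A (\<phi> ` \<Omega>) n
             \<in> Hom k (tensor_power k A n) (self_module k) \<rightarrow> AP k A (\<phi> ` \<Omega>) n) \<and>
         (\<forall>p\<ge>1. \<forall>q\<ge>1.
            \<forall>\<alpha> \<in> Hom k (tensor_power k A p) (self_module k).
            \<forall>\<beta> \<in> Hom k (tensor_power k A q) (self_module k).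
              Psi k A (\<phi> ` \<Omega>) (p + q - 1) (cup_one k A (\<phi> ` \<Omega>) p q \<alpha> \<beta>) =
              pre_lie k A p q (Psi k A (\<phi> ` \<Omega>) p \<alpha>) (Psi k A (\<phi> ` \<Omega>) q \<beta>))"
proof -
  interpret idempotent_basis_algebra k A "\<phi> ` \<Omega>"
    using assms(2-4)
    by (auto simp: idempotent_basis_algebra_def idempotent_basis_algebra_axioms_def)
  show ?thesis using Psi_AP Psi_cup_one by blast
qed

end
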